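(* For all $\tau\in\mathbb{H}$, $$\frac{v^2u}{w^3}+\frac{u^2w}{v^3}-\frac{w^2v}{u^3}=\left(\frac{\eta(\tau)}{\eta(7\tau)}\right)^4+8,$$ $$\frac{w^3}{v^2u}+\frac{v^3}{u^2w}-\frac{u^3}{w^2v}=-\left(\frac{\eta(\tau)}{\eta(7\tau)}\right)^4-5.$$
   Context: Let $\tau\in\mathbb{H}$, $q=e^{2\pi i\tau}$, $q^{\alpha}=e^{2\pi i\alpha\tau}$. Define $u=q^{1/56}\prod_{k\ge0}(1-q^{7k+3})(1-q^{7k+4})(1-q^{7k+7})$, $v=q^{9/56}\prod_{k\ge0}(1-q^{7k+2})(1-q^{7k+5})(1-q^{7k+7})$, $w=q^{25/56}\prod_{k\ge0}(1-q^{7k+1})(1-q^{7k+6})(1-q^{7k+7})$, and $\eta(\tau)=q^{1/24}\prod_{n\ge1}(1-q^n)$. *)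

theory Defs
  imports "HOL-Analysis.Analysis"
begin

definition qpow :: "real \<Rightarrow> complex \<Rightarrow> complex" where
  "qpow \<alpha> \<tau> = exp (2 * of_real pi * \<i> * of_real \<alpha> * \<tau>)"

definition qq :: "complex \<Rightarrow> complex" where
  "qq \<tau> = exp (2 * of_real pi * \<i> * \<tau>)"

definition u_fun :: "complex \<Rightarrow> complex" where
  "u_fun \<tau> = qpow (1/56) \<tau> *
     (\<Prod>k. (1 - qq \<tau> ^ (7*k+3)) * (1 - qq \<tau> ^ (7*k+4)) * (1 - qq \<tau> ^ (7*k+7)))"

definition v_fun :: "complex \<Rightarrow> complex" where
  "v_fun \<tau> = qpow (9/56) \<tau> *
     (\<Prod>k. (1 - qq \<tau> ^ (7*k+2)) * (1 - qq \<tau> ^ (7*k+5)) * (1 - qq \<tau> ^ (7*k+7)))"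

definition w_fun :: "complex \<Rightarrow> complex" where
  "w_fun \<tau> = qpow (25/56) \<tau> *
     (\<Prod>k. (1 - qq \<tau> ^ (7*k+1)) * (1 - qq \<tau> ^ (7*k+6)) * (1 - qq \<tau> ^ (7*k+7)))"

definition eta :: "complex \<Rightarrow> complex" where
  "eta \<tau> = qpow (1/24) \<tau> * (\<Prod>n. (1 - qq \<tau> ^ (n+1)))"

end

theory Submission
  imports Defs
begin

text \<open>
  Let \<open>E(q) = \<Prod>(1 - q\<^sup>n)\<close>, \<open>p = q\<^sup>7\<close>, and write \<open>A = V/W\<close>, \<open>B = U/V\<close>, \<open>D = W/U\<close> for the quotients of the
  infinite products of \<open>u, v, w\<close> at \<open>p\<close>. By the pentagonal number theorem and the quintuple product
  identity, the 7-dissection of \<open>E\<close> is \<open>E(q) = E(p\<^sup>7) (A - q B - q\<^sup>2 + q\<^sup>5 D)\<close>. Jacobi's series for \<open>E(q)\<^sup>3\<close>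
  has no exponents congruent to 2 modulo 7, which gives the Klein quartic \<open>p D = A\<^sup>2 - A B\<^sup>2\<close>. Multiplying
  the dissection over the conjugates \<open>\<zeta>\<^sup>j q\<close>, where \<open>\<zeta>\<^sup>7 = 1\<close>, and reducing modulo the quartic yields
  \<open>(E(p) / E(p\<^sup>7))\<^sup>8 = G(p)\<^sup>2\<close>, where \<open>G(p) / p + 8\<close> is the left-hand side of the first claim. The two square
  roots are continuous in the unit disc and agree at \<open>0\<close>, hence everywhere. The second claim follows
  since the quartic says that the three summands \<open>a, b, c\<close> satisfy \<open>a (1 - b) = b (1 - c) = c (1 - a) = 1\<close>.
\<close>

section \<open>Gaussian sums over the integers\<close>

lemma summable_on_exp_neg_abs_int: "(\<lambda>n::int. exp (- \<bar>of_int n\<bar> :: real)) summable_on UNIV"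
proof -
  have geo: "summable (\<lambda>n::nat. exp (- 1 :: real) ^ n)"
    by (rule summable_geometric) simp
  have nat: "(\<lambda>n::nat. exp (- real n)) summable_on UNIV"
    using geo by (intro norm_summable_imp_summable_on) (simp flip: exp_of_nat_mult)
  have pos: "(\<lambda>n::int. exp (- \<bar>of_int n\<bar> :: real)) summable_on range int"
    by (subst summable_on_reindex) (use nat in \<open>simp_all add: o_def inj_def\<close>)
  have neg: "(\<lambda>n::int. exp (- \<bar>of_int n\<bar> :: real)) summable_on range (\<lambda>n. - int n)"
    by (subst summable_on_reindex) (use nat in \<open>simp_all add: o_def inj_def\<close>)
  have "range int \<union> range (\<lambda>n. - int n) = UNIV"
    by (metis (no_types, lifting) UNIV_eq_I UnCI int_cases2 rangeI)
  with summable_on_union[OF pos neg] show ?thesis by simp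
qed

text \<open>Completing the square bounds \<open>(\<bar>b\<bar> + 2) * x - c * x\<^sup>2\<close> by a
  constant. The surplus \<open>2 * x\<close> is spent twice: one \<open>x\<close> absorbs the factor
  \<open>\<bar>of_int n\<bar>\<close>, the other leaves exponential decay.\<close>

lemma quadratic_exp_bound:
  fixes a b :: real and n :: int
  assumes "a < 0"
  shows "\<bar>of_int n\<bar> * exp (a * of_int n ^ 2 + b * of_int n)
           \<le> exp ((\<bar>b\<bar> + 2)\<^sup>2 / (4 * - a)) * exp (- \<bar>of_int n\<bar>)" (is ?th1)
    and "exp (a * of_int n ^ 2 + b * of_int n)
           \<le> exp ((\<bar>b\<bar> + 2)\<^sup>2 / (4 * - a)) * exp (- \<bar>of_int n\<bar>)" (is ?th2)
proof -
  define x where "x = \<bar>real_of_int n\<bar>"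
  define c where "c = - a"
  have c: "c > 0" using assms by (simp add: c_def)
  have "0 \<le> (2 * c * x - (\<bar>b\<bar> + 2))\<^sup>2" by simp
  hence "(\<bar>b\<bar> + 2) * x - c * x\<^sup>2 \<le> (\<bar>b\<bar> + 2)\<^sup>2 / (4 * c)"
    using c by (simp add: field_simps power2_eq_square)
  moreover have "b * of_int n \<le> \<bar>b\<bar> * x"
    by (metis abs_ge_self abs_mult x_def)
  moreover have "a * of_int n ^ 2 = - c * x\<^sup>2"
    by (simp add: x_def c_def)
  ultimately have "x + (a * of_int n ^ 2 + b * of_int n) \<le> (\<bar>b\<bar> + 2)\<^sup>2 / (4 * c) - x"
    by (simp add: algebra_simps)
  hence "exp (x + (a * of_int n ^ 2 + b * of_int n)) \<le> exp ((\<bar>b\<bar> + 2)\<^sup>2 / (4 * c) - x)"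
    by simp
  hence *: "exp x * exp (a * of_int n ^ 2 + b * of_int n)
           \<le> exp ((\<bar>b\<bar> + 2)\<^sup>2 / (4 * c)) * exp (- x)"
    unfolding exp_add[of x] exp_diff by (simp only: exp_minus field_class.field_divide_inverse)
  have "x * exp (a * of_int n ^ 2 + b * of_int n) \<le> exp x * exp (a * of_int n ^ 2 + b * of_int n)"
    using exp_ge_add_one_self[of x] by (intro mult_right_mono) (linarith, simp)
  with * show ?th1 unfolding x_def c_def by linarith
  have "1 * exp (a * of_int n ^ 2 + b * of_int n) \<le> exp x * exp (a * of_int n ^ 2 + b * of_int n)"
    by (intro mult_right_mono) (auto simp: x_def)
  with * show ?th2 unfolding x_def c_def by linarith
qed

text \<open>Nome and variable enter through their logarithms: half-integral powers need no choice of
  branch, and identities between terms become polynomial identities in the exponents.\<close>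

definition theta_term :: "complex \<Rightarrow> complex \<Rightarrow> int \<Rightarrow> complex"
  where "theta_term A B n = (-1) powi n * exp (A * of_int n ^ 2 + B * of_int n)"

definition theta :: "complex \<Rightarrow> complex \<Rightarrow> complex"
  where "theta A B = (\<Sum>\<^sub>\<infinity>n. theta_term A B n)"

lemma norm_th_term: "norm (theta_term A B n) = exp (Re A * of_int n ^ 2 + Re B * of_int n)"
proof -
  have "Re (of_int n ^ 2 :: complex) = of_int n ^ 2" "Im (of_int n ^ 2 :: complex) = 0"
    by (simp_all flip: of_int_power)
  thus ?thesis
    by (simp add: theta_term_def norm_mult norm_power_int norm_exp_eq_Re)
qed

lemma theta_abs_summable:
  assumes "Re A < 0"
  shows "(\<lambda>n. norm (theta_term A B n)) summable_on UNIV"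
    "(\<lambda>n. norm (of_int n * theta_term A B n)) summable_on UNIV"
proof -
  define K where "K = exp ((\<bar>Re B\<bar> + 2)\<^sup>2 / (4 * - Re A))"
  have K: "(\<lambda>n::int. K * exp (- \<bar>of_int n\<bar> :: real)) summable_on UNIV"
    by (intro summable_on_cmult_right summable_on_exp_neg_abs_int)
  show "(\<lambda>n. norm (theta_term A B n)) summable_on UNIV"
    by (rule summable_on_comparison_test[OF K])
       (use quadratic_exp_bound(2)[OF assms] in \<open>auto simp: norm_th_term K_def\<close>)
  show "(\<lambda>n. norm (of_int n * theta_term A B n)) summable_on UNIV"
    by (rule summable_on_comparison_test[OF K])
       (use quadratic_exp_bound(1)[OF assms] in \<open>auto simp: norm_th_term K_def norm_mult\<close>)
qed

text \<open>Dominated convergence for two-sided series, reduced to one-sided series by enumerating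
  the integers with \<open>int_decode\<close>.\<close>

lemma tannery_int:
  fixes a :: "int \<Rightarrow> nat \<Rightarrow> complex"
  assumes limit: "\<And>n. (\<lambda>N. a n N) \<longlonglongrightarrow> b n"
    and bound: "\<And>n N. norm (a n N) \<le> M n"
    and M: "M summable_on UNIV"
  shows "(\<lambda>N. \<Sum>\<^sub>\<infinity>n. a n N) \<longlonglongrightarrow> (\<Sum>\<^sub>\<infinity>n. b n)"
proof -
  have bij: "bij int_decode" by (rule bij_int_decode)
  have M': "summable (\<lambda>k. M (int_decode k))"
    by (rule summable_on_imp_summable) (use M summable_on_reindex_bij_betw[OF bij, of M] in simp)
  have bb: "norm (b n) \<le> M n" for n
    by (rule LIMSEQ_le_const2[OF tendsto_norm[OF limit]]) (use bound in auto)
  have infsum: "(\<Sum>\<^sub>\<infinity>n. f n) = (\<Sum>k. f (int_decode k))"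
    if "\<And>n. norm (f n) \<le> M n" for f :: "int \<Rightarrow> complex"
  proof -
    have "f summable_on UNIV"
      by (rule abs_summable_summable[OF summable_on_comparison_test[OF M]]) (use that in simp_all)
    hence "(f has_sum infsum f UNIV) UNIV" by simp
    hence "((\<lambda>k. f (int_decode k)) has_sum infsum f UNIV) UNIV"
      using has_sum_reindex_bij_betw[OF bij] by blast
    thus ?thesis by (intro sums_unique has_sum_imp_sums)
  qed
  have "(\<lambda>N. \<Sum>k. a (int_decode k) N) \<longlonglongrightarrow> (\<Sum>k. b (int_decode k))"
    by (rule tannerys_theorem[where M = "\<lambda>k. M (int_decode k)", THEN conjunct2, THEN conjunct2])
       (simp_all add: limit bound M' case_prod_beta always_eventually)
  thus ?thesis unfolding infsum[OF bound] infsum[OF bb] .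
qed

text \<open>The unconditional sum over pairs is what permits the lattice rearrangements behind the
  quintuple product.\<close>

lemma has_sum_Times_mult:
  fixes f g :: "int \<Rightarrow> complex"
  assumes "(\<lambda>n. norm (f n)) summable_on UNIV" "(\<lambda>n. norm (g n)) summable_on UNIV"
  shows "((\<lambda>(m, n). f m * g n) has_sum (infsum f UNIV * infsum g UNIV)) UNIV"
proof -
  have "(\<lambda>(m, n). norm (f m) * norm (g n)) summable_on UNIV \<times> UNIV"
    by (rule summable_on_SigmaI[where g = "\<lambda>m. norm (f m) * infsum (\<lambda>n. norm (g n)) UNIV"])
       (simp_all add: assms has_sum_cmult_right summable_on_cmult_left)
  hence "(\<lambda>x. norm ((\<lambda>(m, n). f m * g n) x)) summable_on UNIV \<times> UNIV"
    by (simp add: case_prod_unfold norm_mult)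
  hence summ: "(\<lambda>(m, n). f m * g n) summable_on UNIV \<times> UNIV"
    by (rule abs_summable_summable)
  have f: "(f has_sum infsum f UNIV) UNIV" and g: "(g has_sum infsum g UNIV) UNIV"
    using assms by (simp_all add: abs_summable_summable)
  have "((\<lambda>(m, n). f m * g n) has_sum (infsum f UNIV * infsum g UNIV)) (UNIV \<times> UNIV)"
    by (rule has_sum_SigmaI[where g = "\<lambda>m. f m * infsum g UNIV"])
       (simp_all add: has_sum_cmult_right[OF g] has_sum_cmult_left[OF f] summ[simplified])
  thus ?thesis by simp
qed

lemma theta_shift: "theta A (B + 2 * A) = - exp (- A - B) * theta A B"
proof -
  have "theta_term A (B + 2 * A) n = - exp (- A - B) * theta_term A B (n + 1)" for n
    by (simp add: theta_term_def power_int_add field_simps power2_eq_square flip: exp_add)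
  hence "theta A (B + 2 * A) = (\<Sum>\<^sub>\<infinity>n. - exp (- A - B) * theta_term A B (n + 1))"
    by (simp add: theta_def)
  also have "\<dots> = - exp (- A - B) * (\<Sum>\<^sub>\<infinity>n. theta_term A B (n + 1))"
    by (rule infsum_cmult_right')
  also have "(\<Sum>\<^sub>\<infinity>n. theta_term A B (n + 1)) = theta A B"
    unfolding theta_def by (rule infsum_reindex_bij_witness[of _ "\<lambda>n. n - 1" "\<lambda>n. n + 1"]) simp_all
  finally show ?thesis .
qed

section \<open>Infinite products and the q-binomial theorem\<close>

text \<open>In standard notation this is the q-Pochhammer symbol (q^r; q^m)_infinity;
  \<open>qprod 1 1\<close> is Euler's product.\<close>

definition qprod :: "nat \<Rightarrow> nat \<Rightarrow> complex \<Rightarrow> complex"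
  where "qprod m r q = (\<Prod>k. 1 - q ^ (m * k + r))"

lemma norm_power_lt_1:
  fixes q :: complex
  assumes "norm q < 1" "n > 0"
  shows "norm (q ^ n) < 1"
  using assms by (simp add: norm_power power_less_one_iff)

lemma one_minus_power_nonzero:
  fixes q :: complex
  assumes "norm q < 1" "n > 0"
  shows "1 - q ^ n \<noteq> 0"
  using norm_power_lt_1[OF assms] by auto

lemma norm_power_arith_le:
  fixes q :: complex
  assumes "norm q \<le> c" "c < 1" "m > 0"
  shows "norm (q ^ (m * k + r)) \<le> c ^ k"
proof -
  have "norm q ^ (m * k + r) \<le> norm q ^ k"
    using assms by (intro power_decreasing trans_le_add1) auto
  also have "\<dots> \<le> c ^ k"
    using assms by (intro power_mono) auto
  finally show ?thesis by (simp add: norm_power)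
qed

lemma qprod_convergent:
  fixes q :: complex
  assumes "norm q < 1" "m > 0"
  shows "convergent_prod (\<lambda>k. 1 - q ^ (m * k + r))"
proof -
  have "summable (\<lambda>k. norm (1 - q ^ (m * k + r) - 1))"
    by (rule summable_comparison_test'[OF summable_geometric[of "norm q"], of 0])
       (use norm_power_arith_le[OF order_refl assms] assms in auto)
  thus ?thesis
    by (intro abs_convergent_prod_imp_convergent_prod summable_imp_abs_convergent_prod)
qed

lemma qprod_nonzero:
  assumes "norm q < 1" "m > 0" "r > 0"
  shows "qprod m r q \<noteq> 0"
  unfolding qprod_def using assms
  by (intro prodinf_nonzero qprod_convergent one_minus_power_nonzero) auto

lemma qprod_LIMSEQ:
  assumes "norm q < 1" "m > 0"
  shows "(\<lambda>N. \<Prod>k<N. 1 - q ^ (m * k + r)) \<longlonglongrightarrow> qprod m r q"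
  using convergent_prod_LIMSEQ[OF qprod_convergent[OF assms]]
  by (simp add: qprod_def LIMSEQ_lessThan_iff_atMost)

lemma qprod_0 [simp]: "r > 0 \<Longrightarrow> qprod m r 0 = 1"
  by (simp add: qprod_def power_0_left)

text \<open>On a closed disc of radius c < 1 the partial products converge uniformly, with majorant
  \<open>c ^ k\<close>. Continuity later fixes the sign of a square root.\<close>

lemma qprod_continuous:
  assumes "m > 0"
  shows "continuous_on (ball 0 1) (qprod m r)"
proof -
  have "continuous_on (cball 0 c) (qprod m r)" if c: "c < 1" for c
  proof -
    let ?f = "\<lambda>N q :: complex. \<Prod>k<N. 1 - q ^ (m * k + r)"
    have "uniformly_convergent_on (cball 0 c) (\<lambda>N q. \<Sum>k<N. norm (1 - q ^ (m * k + r) - 1 :: complex))"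
    proof (cases "c \<ge> 0")
      case True
      show ?thesis
        by (rule Weierstrass_m_test'[of _ _ "\<lambda>k. c ^ k"])
           (use norm_power_arith_le[of _ c m] c assms True in auto)
    qed (auto simp: uniformly_convergent_on_def)
    hence unif: "uniformly_convergent_on (cball 0 c) ?f"
      by (rule uniformly_convergent_on_prod'[rotated 2]) (auto intro!: continuous_intros)
    have "uniform_limit (cball 0 c) ?f (qprod m r) sequentially"
    proof -
      obtain l where l: "uniform_limit (cball 0 c) ?f l sequentially"
        using unif by (auto simp: uniformly_convergent_on_def)
      have "l q = qprod m r q" if "q \<in> cball 0 c" for q
        by (rule LIMSEQ_unique[OF tendsto_uniform_limitI[OF l that] qprod_LIMSEQ])
           (use that c assms in auto)
      with l show ?thesis by (metis (no_types, lifting) uniform_limit_cong')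
    qed
    thus ?thesis
      by (rule uniform_limit_theorem[rotated]) (auto intro!: always_eventually continuous_intros)
  qed
  hence "continuous (at q) (qprod m r)" if "norm q < 1" for q
  proof -
    obtain c where c: "norm q < c" "c < 1" using \<open>norm q < 1\<close> dense by blast
    have "continuous_on (ball 0 c) (qprod m r)"
      by (rule continuous_on_subset[OF \<open>\<And>c. c < 1 \<Longrightarrow> continuous_on (cball 0 c) (qprod m r)\<close>[OF c(2)]]) auto
    thus ?thesis using c by (simp add: continuous_on_eq_continuous_at)
  qed
  thus ?thesis by (simp add: continuous_on_eq_continuous_at)
qed

lemma tendsto_prod_merge:
  fixes f :: "nat \<Rightarrow> complex"
  assumes "(\<lambda>N. \<Prod>k<N. f k) \<longlonglongrightarrow> l" "d > 0"
  shows "(\<lambda>N. \<Prod>k<d * N. f k) \<longlonglongrightarrow> l"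
  using LIMSEQ_subseq_LIMSEQ[OF assms(1), of "\<lambda>N. d * N"] assms(2)
  by (simp add: o_def strict_mono_def)

section \<open>Gaussian binomial coefficients and the finite triple product\<close>

definition qfac :: "complex \<Rightarrow> nat \<Rightarrow> complex"
  where "qfac q n = (\<Prod>k<n. 1 - q ^ (k + 1))"

text \<open>The Gaussian binomial coefficient; \<open>qfac\<close> omits the usual denominators 1 -
  q, whose powers cancel in the quotient.\<close>

definition qbinom :: "complex \<Rightarrow> nat \<Rightarrow> nat \<Rightarrow> complex"
  where "qbinom q n k = (if k \<le> n then qfac q n / (qfac q k * qfac q (n - k)) else 0)"

lemma qfac_0 [simp]: "qfac q 0 = 1" by (simp add: qfac_def)
lemma qfac_Suc: "qfac q (Suc n) = (1 - q ^ Suc n) * qfac q n" by (simp add: qfac_def)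

lemma qfac_nonzero: "norm q < 1 \<Longrightarrow> qfac q n \<noteq> 0"
  using one_minus_power_nonzero[of q] by (auto simp: qfac_def simp del: power_Suc)

lemma qbinom_0 [simp]: "norm q < 1 \<Longrightarrow> qbinom q n 0 = 1"
  by (simp add: qbinom_def qfac_nonzero)

lemma qbinom_pascal:
  assumes "norm q < 1"
  shows "qbinom q (Suc n) (Suc k) = q ^ Suc k * qbinom q n (Suc k) + qbinom q n k"
proof (cases "k < n")
  case True
  define d where "d = n - Suc k"
  have n: "n = Suc k + d" using True by (simp add: d_def)
  have "1 - q ^ Suc k \<noteq> 0" "1 - q ^ Suc d \<noteq> 0"
    by (rule one_minus_power_nonzero[OF assms], simp)+
  moreover have "qfac q k \<noteq> 0" "qfac q d \<noteq> 0"
    using qfac_nonzero[OF assms] by auto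
  ultimately show ?thesis
    unfolding n by (simp add: qbinom_def qfac_Suc divide_simps) (simp add: power_add algebra_simps)
next
  case False
  thus ?thesis using qfac_nonzero[OF assms] by (auto simp: qbinom_def)
qed

text \<open>Removing the first factor leaves the same product at \<open>x * q\<close>, hence the
  induction over arbitrary \<open>x\<close>. The coefficients then match by the q-Pascal
  rule.\<close>

lemma q_binomial_theorem:
  assumes "norm q < 1"
  shows "(\<Prod>k<n. 1 + x * q ^ k) = (\<Sum>k\<le>n. qbinom q n k * q ^ (k * (k - 1) div 2) * x ^ k)"
proof (induction n arbitrary: x)
  case (Suc n)
  have tri: "Suc k * k div 2 = k + k * (k - 1) div 2" for k :: nat
    by (cases k) (simp_all add: algebra_simps)
  let ?t = "\<lambda>m k. qbinom q m k * q ^ (k * (k - 1) div 2) * x ^ k"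
  have "(\<Prod>k<Suc n. 1 + x * q ^ k) = (1 + x) * (\<Prod>k<n. 1 + (x * q) * q ^ k)"
    by (subst prod.lessThan_Suc_shift) (simp add: mult_ac)
  also have "\<dots> = (\<Sum>k\<le>n. ?t n k * q ^ k) + (\<Sum>k\<le>n. x * (?t n k * q ^ k))"
    unfolding Suc.IH distrib_right by (simp add: mult_ac power_mult_distrib sum_distrib_left)
  also have "(\<Sum>k\<le>n. ?t n k * q ^ k) = (\<Sum>k\<le>Suc n. ?t n k * q ^ k)"
    by (simp add: qbinom_def)
  also have "\<dots> = 1 + (\<Sum>k\<le>n. ?t n (Suc k) * q ^ Suc k)"
    by (subst sum.atMost_Suc_shift) (simp add: assms)
  also have "1 + (\<Sum>k\<le>n. ?t n (Suc k) * q ^ Suc k) + (\<Sum>k\<le>n. x * (?t n k * q ^ k))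
      = 1 + (\<Sum>k\<le>n. ?t (Suc n) (Suc k))"
  proof -
    have "?t n (Suc k) * q ^ Suc k + x * (?t n k * q ^ k) = ?t (Suc n) (Suc k)" for k
    proof -
      have "q ^ (Suc k * (Suc k - 1) div 2) = q ^ k * q ^ (k * (k - 1) div 2)"
        unfolding diff_Suc_1 tri power_add ..
      thus ?thesis
        unfolding qbinom_pascal[OF assms] by (simp only:) (simp add: algebra_simps)
    qed
    thus ?thesis by (simp only: add.assoc flip: sum.distrib)
  qed
  also have "\<dots> = (\<Sum>k\<le>Suc n. ?t (Suc n) k)"
    by (simp only: sum.atMost_Suc_shift) (simp add: assms)
  finally show ?case .
qed (simp add: assms)

text \<open>This is the q-binomial theorem with \<open>2 * N\<close> factors at
  \<open>x = - z / q ^ N\<close>. The last N factors are \<open>1 - z * q ^ k\<close>; the first N,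
  reversed, are \<open>1 - z / q ^ (k + 1)\<close>. Rewriting the latter with
  \<open>q ^ (k + 1) / z\<close> costs a monomial, which cancels after centring the sum by j = N +
  n.\<close>

lemma q_int_binomial:
  assumes q: "norm q < 1" "q \<noteq> 0" and z: "z \<noteq> 0"
  shows "(\<Prod>k<N. (1 - z * q ^ k) * (1 - q ^ (k + 1) / z)) =
    (\<Sum>n\<in>{-int N..int N}. qbinom q (2 * N) (nat (int N + n)) * ((-1) powi n * q powi (n * (n - 1) div 2) * z powi n))"
proof -
  have neg: "(\<Prod>k<N. 1 - z / q ^ (k + 1)) = (- z) ^ N / q ^ (N * (N + 1) div 2) * (\<Prod>k<N. 1 - q ^ (k + 1) / z)"
  proof -
    have pw: "(\<Prod>k<N. - z / q ^ (k + 1)) = (- z) ^ N / q ^ (N * (N + 1) div 2)"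
    proof (induction N)
      case (Suc N)
      have "Suc N * (Suc N + 1) div 2 = N * (N + 1) div 2 + (N + 1)" by simp
      hence pq: "q ^ (Suc N * (Suc N + 1) div 2) = q ^ (N * (N + 1) div 2) * q ^ (N + 1)"
        by (simp only: power_add)
      thus ?case unfolding prod.lessThan_Suc Suc.IH pq by simp
    qed simp
    have "(\<Prod>k<N. 1 - z / q ^ (k + 1)) = (\<Prod>k<N. (- z / q ^ (k + 1)) * (1 - q ^ (k + 1) / z))"
      using q z by (intro prod.cong) (auto simp: divide_simps)
    thus ?thesis unfolding prod.distrib pw .
  qed
  have "(\<Prod>k<2 * N. 1 + (- z / q ^ N) * q ^ k) = (\<Prod>k<N. 1 - z / q ^ (k + 1)) * (\<Prod>k<N. 1 - z * q ^ k)"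
  proof -
    have "(\<Prod>k<2 * N. 1 + (- z / q ^ N) * q ^ k)
      = (\<Prod>k<N. 1 + (- z / q ^ N) * q ^ k) * (\<Prod>k\<in>{N..<2*N}. 1 + (- z / q ^ N) * q ^ k)"
      by (subst prod.union_disjoint [symmetric]) (auto intro!: prod.cong)
    also have "(\<Prod>k<N. 1 + (- z / q ^ N) * q ^ k) = (\<Prod>k<N. 1 + (- z / q ^ N) * q ^ (N - Suc k))"
      by (rule prod.nat_diff_reindex [symmetric])
    also have "\<dots> = (\<Prod>k<N. 1 - z / q ^ (k + 1))"
      using q by (intro prod.cong) (auto simp: power_diff field_simps)
    also have "(\<Prod>k\<in>{N..<2*N}. 1 + (- z / q ^ N) * q ^ k) = (\<Prod>k<N. 1 - z * q ^ k)"
      by (rule prod.reindex_bij_witness[of _ "\<lambda>k. N + k" "\<lambda>k. k - N"])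
         (use q in \<open>auto simp: power_diff field_simps\<close>)
    finally show ?thesis .
  qed
  hence "(- z) ^ N / q ^ (N * (N + 1) div 2) * (\<Prod>k<N. (1 - z * q ^ k) * (1 - q ^ (k + 1) / z))
      = (\<Sum>j\<le>2 * N. qbinom q (2 * N) j * q ^ (j * (j - 1) div 2) * (- z / q ^ N) ^ j)"
    unfolding q_binomial_theorem[OF q(1)] neg prod.distrib by (simp add: mult_ac)
  also have "\<dots> = (- z) ^ N / q ^ (N * (N + 1) div 2) *
    (\<Sum>n\<in>{-int N..int N}. qbinom q (2 * N) (nat (int N + n)) * ((-1) powi n * q powi (n * (n - 1) div 2) * z powi n))"
    unfolding sum_distrib_left
  proof (rule sum.reindex_bij_witness[of _ "\<lambda>n. nat (int N + n)" "\<lambda>j. int j - int N"]; (simp add: nat_le_iff; fail)?)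
    fix j assume "j \<in> {..2 * N}"
    define n where "n = int j - int N"
    have j: "int j = int N + n" by (simp add: n_def)
    have evj: "int (j * (j - 1) div 2) = int j * (int j - 1) div 2"
      by (cases j) (auto simp: zdiv_int algebra_simps)
    have "int j * (int j - 1) div 2 + int (N * (N + 1) div 2) = n * (n - 1) div 2 + int (N * j)"
    proof -
      have tri: "2 * (int j * (int j - 1) div 2) = int j * (int j - 1)"
           "2 * (n * (n - 1) div 2) = n * (n - 1)"
           "2 * int (N * (N + 1) div 2) = int N * (int N + 1)"
        by (auto simp: zdiv_int algebra_simps)
      have "2 * (int j * (int j - 1) div 2 + int (N * (N + 1) div 2))
          = 2 * (n * (n - 1) div 2 + int (N * j))"
        unfolding distrib_left[of "2::int"] tri by (simp add: j algebra_simps)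
      thus ?thesis by simp
    qed
    hence pw: "q powi (int j * (int j - 1) div 2) * q ^ (N * (N + 1) div 2) = q powi (n * (n - 1) div 2) * q ^ (N * j)"
      using q by (metis power_int_add power_int_of_nat)
    have zz: "(- z) ^ j = (- z) ^ N * ((-1) powi n * z powi n)"
    proof -
      have "(- z) powi int j = (- z) powi int N * (- z) powi n"
        unfolding j using z by (intro power_int_add) auto
      thus ?thesis by (simp add: power_int_minus_left flip: power_int_mult_distrib)
    qed
    show "(- z) ^ N / q ^ (N * (N + 1) div 2) *
       (qbinom q (2 * N) (nat (int N + (int j - int N))) *
        ((- 1) powi (int j - int N) *
         q powi ((int j - int N) * (int j - int N - 1) div 2) *
         z powi (int j - int N))) =
      qbinom q (2 * N) j * q ^ (j * (j - 1) div 2) * (- z / q ^ N) ^ j"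
    proof -
      have frac: "(- z / q ^ N) ^ j = (- z) ^ j / q ^ (N * j)"
        by (simp only: power_divide power_mult)
      have nj: "nat (int N + n) = j" by (simp flip: j)
      have "q ^ (j * (j - 1) div 2) = q powi (int j * (int j - 1) div 2)"
        by (simp flip: evj)
      thus ?thesis
        unfolding n_def[symmetric] frac zz nj using pw q
        by (simp add: field_simps)
    qed
  qed
  finally show ?thesis using q z by simp
qed

section \<open>The Jacobi triple product and its consequences\<close>

lemma exp_powi: "exp (x :: complex) powi n = exp (of_int n * x)"
  by (simp add: exp_power_int)

lemma exp_pow: "exp (x :: complex) ^ n = exp (of_nat n * x)"
  by (simp add: exp_of_nat_mult)

lemma of_int_triangle: "(of_int (n * (n - 1) div 2) :: complex) = of_int n * (of_int n - 1) / 2"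
proof -
  have "2 * (n * (n - 1) div 2) = n * (n - 1)" by simp
  hence "(2 :: complex) * of_int (n * (n - 1) div 2) = of_int (n * (n - 1))"
    by (metis of_int_mult of_int_numeral)
  thus ?thesis by (simp add: field_simps)
qed

lemma theta_term_powi:
  "theta_term (L / 2) (l - L / 2) n = (-1) powi n * exp L powi (n * (n - 1) div 2) * exp l powi n"
  unfolding theta_term_def exp_powi of_int_triangle mult.assoc exp_add[symmetric]
  by (simp add: field_simps power2_eq_square)

lemma qfac_LIMSEQ: "norm q < 1 \<Longrightarrow> qfac q \<longlonglongrightarrow> qprod 1 1 q"
  using qprod_LIMSEQ[of q 1 1] by (simp add: qfac_def[abs_def])

text \<open>All three q-factorials of the central coefficient tend to Euler's product, and one copy
  cancels.\<close>

lemma qbinom_central_LIMSEQ: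
  assumes "norm q < 1"
  shows "(\<lambda>N. qbinom q (2 * N) (nat (int N + n))) \<longlonglongrightarrow> 1 / qprod 1 1 q"
proof -
  have lim: "(\<lambda>N. qfac q (f N)) \<longlonglongrightarrow> qprod 1 1 q" if "filterlim f sequentially sequentially" for f
    using filterlim_compose[OF qfac_LIMSEQ[OF assms] that] .
  have shift: "filterlim (\<lambda>N. nat (int N + j)) sequentially sequentially" for j :: int
    unfolding filterlim_at_top
  proof
    fix Z :: nat
    show "\<forall>\<^sub>F N in sequentially. Z \<le> nat (int N + j)"
      by (rule eventually_sequentiallyI[of "Z + nat \<bar>j\<bar>"]) auto
  qed
  have double: "filterlim (\<lambda>N::nat. 2 * N) sequentially sequentially"
    by (rule filterlim_subseq) (simp add: strict_mono_def)
  have nz: "qprod 1 1 q \<noteq> 0" using qprod_nonzero[OF assms] by simp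
  have "(\<lambda>N. qfac q (2 * N) / (qfac q (nat (int N + n)) * qfac q (nat (int N + (- n)))))
      \<longlonglongrightarrow> qprod 1 1 q / (qprod 1 1 q * qprod 1 1 q)"
    using nz by (intro tendsto_intros lim double shift) auto
  hence "(\<lambda>N. qfac q (2 * N) / (qfac q (nat (int N + n)) * qfac q (nat (int N + (- n)))))
      \<longlonglongrightarrow> 1 / qprod 1 1 q"
    using nz by (simp add: field_simps)
  moreover have "\<forall>\<^sub>F N in sequentially. qfac q (2 * N) / (qfac q (nat (int N + n)) * qfac q (nat (int N + (- n))))
      = qbinom q (2 * N) (nat (int N + n))"
  proof (rule eventually_sequentiallyI[of "nat \<bar>n\<bar>"])
    fix N assume N: "nat \<bar>n\<bar> \<le> N"
    hence "2 * N - nat (int N + n) = nat (int N + (- n))" "nat (int N + n) \<le> 2 * N"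
      by (auto simp: nat_le_iff)
    thus "qfac q (2 * N) / (qfac q (nat (int N + n)) * qfac q (nat (int N + (- n))))
      = qbinom q (2 * N) (nat (int N + n))"
      by (simp add: qbinom_def)
  qed
  ultimately show ?thesis by (rule Lim_transform_eventually)
qed

text \<open>The q-factorials converge to a nonzero limit, so they and their inverses are bounded.
  The bound, uniform in n and k, gives the majorant for Tannery's theorem.\<close>

lemma qbinom_bounded:
  assumes "norm q < 1"
  obtains C where "C > 0" "\<And>n k. norm (qbinom q n k) \<le> C"
proof -
  have nz: "qprod 1 1 q \<noteq> 0" using qprod_nonzero[OF assms] by simp
  have "Bseq (qfac q)"
    using qfac_LIMSEQ[OF assms] convergentI convergent_imp_Bseq by blast
  then obtain B where B: "B > 0" "\<And>n. norm (qfac q n) \<le> B" by (auto elim: BseqE)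
  have "Bseq (\<lambda>n. inverse (qfac q n))"
    using tendsto_inverse[OF qfac_LIMSEQ[OF assms] nz] convergentI convergent_imp_Bseq by blast
  then obtain b where b: "b > 0" "\<And>n. norm (inverse (qfac q n)) \<le> b" by (auto elim: BseqE)
  show ?thesis
  proof (rule that[of "B * (b * b)"])
    fix n k
    have "norm (qfac q n) * (norm (inverse (qfac q k)) * norm (inverse (qfac q (n - k)))) \<le> B * (b * b)"
      using B b by (intro mult_mono) auto
    thus "norm (qbinom q n k) \<le> B * (b * b)"
      using B b by (auto simp: qbinom_def norm_divide norm_mult norm_inverse divide_inverse)
  qed (use B b in auto)
qed

text \<open>The weight \<open>f\<close> is arbitrary so that one limit serves both the triple
  product and its derivative, where an extra factor n appears.\<close>

lemma qbinom_weighted_LIMSEQ: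
  assumes q: "norm q < 1" and f: "(\<lambda>n. norm (f n)) summable_on UNIV"
  shows "(\<lambda>N. \<Sum>n\<in>{- int N..int N}. qbinom q (2 * N) (nat (int N + n)) * f n)
           \<longlonglongrightarrow> (\<Sum>\<^sub>\<infinity>n. f n) / qprod 1 1 q"
proof -
  define g where "g n N = (if n \<in> {- int N..int N} then qbinom q (2 * N) (nat (int N + n)) * f n else 0)"
    for n N
  obtain C where C: "C > 0" "\<And>n k. norm (qbinom q n k) \<le> C" using qbinom_bounded[OF q] by blast
  have "(\<lambda>N. \<Sum>\<^sub>\<infinity>n. g n N) \<longlonglongrightarrow> (\<Sum>\<^sub>\<infinity>n. 1 / qprod 1 1 q * f n)"
  proof (rule tannery_int)
    fix n
    have "(\<lambda>N. qbinom q (2 * N) (nat (int N + n)) * f n) \<longlonglongrightarrow> 1 / qprod 1 1 q * f n"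
      by (intro tendsto_intros qbinom_central_LIMSEQ q)
    moreover have "\<forall>\<^sub>F N in sequentially. qbinom q (2 * N) (nat (int N + n)) * f n = g n N"
      by (rule eventually_sequentiallyI[of "nat \<bar>n\<bar>"]) (auto simp: g_def)
    ultimately show "g n \<longlonglongrightarrow> 1 / qprod 1 1 q * f n"
      by (rule Lim_transform_eventually)
  next
    fix n N show "norm (g n N) \<le> C * norm (f n)"
      using C by (auto simp: g_def norm_mult intro!: mult_right_mono)
  next
    show "(\<lambda>n. C * norm (f n)) summable_on UNIV"
      by (rule summable_on_cmult_right[OF f])
  qed
  moreover have "(\<Sum>\<^sub>\<infinity>n. g n N) = (\<Sum>n\<in>{- int N..int N}. qbinom q (2 * N) (nat (int N + n)) * f n)" for N
  proof -
    have "(\<Sum>\<^sub>\<infinity>n. g n N) = (\<Sum>\<^sub>\<infinity>n\<in>{- int N..int N}. qbinom q (2 * N) (nat (int N + n)) * f n)"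
      by (rule infsum_cong_neutral) (auto simp: g_def)
    thus ?thesis by simp
  qed
  moreover have "(\<Sum>\<^sub>\<infinity>n. 1 / qprod 1 1 q * f n) = (\<Sum>\<^sub>\<infinity>n. f n) / qprod 1 1 q"
    by (subst infsum_cmult_right') simp
  ultimately show ?thesis by simp
qed

lemma jacobi_triple_product:
  assumes "Re L < 0"
  shows "(\<lambda>N. \<Prod>k<N. (1 - exp l * exp L ^ k) * (1 - exp L ^ (k + 1) / exp l))
           \<longlonglongrightarrow> theta (L / 2) (l - L / 2) / qprod 1 1 (exp L)"
proof -
  have q: "norm (exp L) < 1" using assms by simp
  have "(\<Prod>k<N. (1 - exp l * exp L ^ k) * (1 - exp L ^ (k + 1) / exp l))
     = (\<Sum>n\<in>{- int N..int N}. qbinom (exp L) (2 * N) (nat (int N + n)) * theta_term (L / 2) (l - L / 2) n)"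
    for N
    by (subst q_int_binomial[OF q]) (simp_all add: theta_term_powi)
  moreover have "(\<lambda>n. norm (theta_term (L / 2) (l - L / 2) n)) summable_on UNIV"
    using assms by (intro theta_abs_summable) simp
  ultimately show ?thesis
    using qbinom_weighted_LIMSEQ[OF q] by (simp add: theta_def)
qed

text \<open>The triple product with nome p^m and variable p^a: its factors run through the exponents
  congruent to a, -a and 0 modulo m.\<close>

lemma theta_product:
  assumes "Re M < 0" "0 < a" "a < m"
  shows "theta (of_nat m * M / 2) (of_nat a * M - of_nat m * M / 2)
           = qprod m a (exp M) * qprod m (m - a) (exp M) * qprod m m (exp M)"
proof -
  let ?p = "exp M" and ?L = "of_nat m * M" and ?l = "of_nat a * M"
  have m: "m > 0" using assms by simp
  have p: "norm ?p < 1" using assms by simp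
  have L: "Re ?L < 0" using assms m by (simp add: mult_pos_neg)
  have pL: "exp ?L = ?p ^ m" and pl: "exp ?l = ?p ^ a" by (simp_all add: exp_pow)
  have qpm: "qprod 1 1 (?p ^ m) = qprod m m ?p"
  proof -
    have "(?p ^ m) ^ (1 * k + 1) = ?p ^ (m * k + m)" for k
      unfolding power_mult[symmetric] by (simp add: algebra_simps)
    thus ?thesis by (simp only: qprod_def)
  qed
  have nz: "qprod m m ?p \<noteq> 0" using qprod_nonzero[OF p] m by simp
  have "(\<Prod>k<N. (1 - exp ?l * exp ?L ^ k) * (1 - exp ?L ^ (k + 1) / exp ?l))
      = (\<Prod>k<N. 1 - ?p ^ (m * k + a)) * (\<Prod>k<N. 1 - ?p ^ (m * k + (m - a)))" for N
  proof -
    have "exp ?l * exp ?L ^ k = ?p ^ (m * k + a)" "exp ?L ^ (k + 1) / exp ?l = ?p ^ (m * k + (m - a))" for k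
    proof -
      show "exp ?l * exp ?L ^ k = ?p ^ (m * k + a)"
        unfolding pL pl by (simp add: power_add power_mult)
      have "?p ^ (m * k + (m - a)) * ?p ^ a = (?p ^ m) ^ (k + 1)"
        using assms by (simp add: add.commute flip: power_add power_mult)
      thus "exp ?L ^ (k + 1) / exp ?l = ?p ^ (m * k + (m - a))"
        unfolding pL pl by (metis exp_not_eq_zero nonzero_mult_div_cancel_right power_not_zero)
    qed
    thus ?thesis by (simp only: prod.distrib)
  qed
  moreover have "(\<lambda>N. (\<Prod>k<N. 1 - ?p ^ (m * k + a)) * (\<Prod>k<N. 1 - ?p ^ (m * k + (m - a))))
      \<longlonglongrightarrow> qprod m a ?p * qprod m (m - a) ?p"
    by (intro tendsto_mult qprod_LIMSEQ p m)
  ultimately have "theta (?L / 2) (?l - ?L / 2) / qprod 1 1 (exp ?L) = qprod m a ?p * qprod m (m - a) ?p"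
    using LIMSEQ_unique[OF jacobi_triple_product[OF L, of ?l]] by simp
  thus ?thesis using nz unfolding pL qpm by (simp add: field_simps)
qed

lemma prod_lessThan_times_3:
  fixes f :: "nat \<Rightarrow> complex"
  shows "(\<Prod>k<3 * N. f k) = (\<Prod>k<N. f (3 * k)) * (\<Prod>k<N. f (3 * k + 1)) * (\<Prod>k<N. f (3 * k + 2))"
proof (induction N)
  case (Suc N)
  have three: "3 * Suc N = Suc (Suc (Suc (3 * N)))" by simp
  show ?case unfolding three prod.lessThan_Suc Suc.IH by (simp add: mult_ac)
qed simp

text \<open>The case m = 3, a = 2 of \<open>theta_product\<close>; the residue classes 2, 1 and 0
  modulo 3 together make up Euler's product.\<close>

lemma euler_pentagonal:
  assumes "Re L < 0"
  shows "theta (3 * L / 2) (L / 2) = qprod 1 1 (exp L)"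
proof -
  let ?q = "exp L"
  have q: "norm ?q < 1" using assms by simp
  have th3: "theta (3 * L / 2) (L / 2) = qprod 3 2 ?q * qprod 3 1 ?q * qprod 3 3 ?q"
    using theta_product[OF assms, of 2 3] by (simp add: field_simps)
  have lim1: "(\<lambda>N. \<Prod>k<3 * N. 1 - ?q ^ (1 * k + 1)) \<longlonglongrightarrow> qprod 1 1 ?q"
    by (rule tendsto_prod_merge[OF qprod_LIMSEQ[OF q]]) auto
  have eq: "(\<Prod>k<3 * N. 1 - ?q ^ (1 * k + 1)) = (\<Prod>k<N. 1 - ?q ^ (3 * k + 2)) *
      (\<Prod>k<N. 1 - ?q ^ (3 * k + 1)) * (\<Prod>k<N. 1 - ?q ^ (3 * k + 3))" for N
  proof -
   have exps: "1 * (3 * k) + 1 = 3 * k + 1" "1 * (3 * k + 1) + 1 = 3 * k + 2"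
      "1 * (3 * k + 2) + 1 = 3 * k + 3" for k :: nat by simp_all
    show ?thesis unfolding prod_lessThan_times_3 exps by (simp only: mult_ac)
  qed
  have lim2: "(\<lambda>N. (\<Prod>k<N. 1 - ?q ^ (3 * k + 2)) *
      (\<Prod>k<N. 1 - ?q ^ (3 * k + 1)) * (\<Prod>k<N. 1 - ?q ^ (3 * k + 3)))
      \<longlonglongrightarrow> qprod 3 2 ?q * qprod 3 1 ?q * qprod 3 3 ?q"
    by (intro tendsto_mult qprod_LIMSEQ q) auto
  with th3 show ?thesis using LIMSEQ_unique[OF lim1[unfolded eq] lim2] by simp
qed

text \<open>Differentiate the finite triple product at z = 1. Its factor 1 - z vanishes there, so
  only minus the remaining product \<open>R 1\<close> survives. Working before the limit avoids
  differentiating an infinite series; \<open>Suc N\<close> guarantees that the factor 1 - z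
  occurs.\<close>

lemma qfac_jacobi_cube:
  assumes q: "norm q < 1" "q \<noteq> 0"
  shows "(\<Sum>n\<in>{- int (Suc N)..int (Suc N)}. qbinom q (2 * Suc N) (nat (int (Suc N) + n)) *
           (of_int n * ((-1) powi n * q powi (n * (n - 1) div 2)))) = - qfac q N * qfac q (Suc N)"
proof -
  define c where "c n = qbinom q (2 * Suc N) (nat (int (Suc N) + n)) * ((-1) powi n * q powi (n * (n - 1) div 2))" for n
  define I where "I = {- int (Suc N)..int (Suc N)}"
  define R where "R z = (\<Prod>k<N. 1 - z * q ^ (k + 1)) * (\<Prod>k<Suc N. 1 - q ^ (k + 1) / z)" for z
  have eq: "(\<Sum>n\<in>I. c n * z powi n) = (1 - z) * R z" if "z \<noteq> 0" for z
  proof -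
    have "(\<Sum>n\<in>I. c n * z powi n) = (\<Prod>k<Suc N. (1 - z * q ^ k) * (1 - q ^ (k + 1) / z))"
      unfolding q_int_binomial[OF q that] c_def I_def by (simp add: mult_ac)
    also have "\<dots> = (\<Prod>k<Suc N. 1 - z * q ^ k) * (\<Prod>k<Suc N. 1 - q ^ (k + 1) / z)"
      by (rule prod.distrib)
    also have "(\<Prod>k<Suc N. 1 - z * q ^ k) = (1 - z) * (\<Prod>k<N. 1 - z * q ^ (k + 1))"
      by (subst prod.lessThan_Suc_shift) simp
    finally show ?thesis by (simp add: R_def)
  qed
  have d1: "((\<lambda>z. \<Sum>n\<in>I. c n * z powi n) has_field_derivative (\<Sum>n\<in>I. of_int n * c n)) (at 1)"
    by (rule derivative_eq_intros refl | simp)+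
  have "isCont R 1"
    unfolding R_def by (intro continuous_intros) auto
  \<comment> \<open>By Caratheodory's criterion continuity of \<open>R\<close> at 1 suffices;
    \<open>R\<close> itself need not be differentiated.\<close>
  hence "((\<lambda>z. (1 - z) * R z) has_field_derivative (- R 1)) (at 1)"
    unfolding CARAT_DERIV by (intro exI[of _ "\<lambda>z. - R z"]) (auto simp: algebra_simps)
  hence d2: "((\<lambda>z. \<Sum>n\<in>I. c n * z powi n) has_field_derivative (- R 1)) (at 1)"
    by (rule has_field_derivative_transform_within_open[where S = "- {0}"]) (auto simp: eq)
  have "(\<Sum>n\<in>I. of_int n * c n) = - R 1"
    by (rule DERIV_unique[OF d1 d2])
  thus ?thesis by (simp add: I_def c_def R_def qfac_def mult_ac)
qed

lemma jacobi_cube: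
  assumes "Re L < 0"
  shows "qprod 1 1 (exp L) ^ 3 = - (\<Sum>\<^sub>\<infinity>n. of_int n * theta_term (L / 2) (- L / 2) n)"
proof -
  let ?q = "exp L"
  have q: "norm ?q < 1" using assms by simp
  have nz: "qprod 1 1 ?q \<noteq> 0" using qprod_nonzero[OF q] by simp
  let ?s = "\<lambda>N. \<Sum>n\<in>{- int N..int N}. qbinom ?q (2 * N) (nat (int N + n)) * (of_int n * theta_term (L / 2) (- L / 2) n)"
  have "?s \<longlonglongrightarrow> (\<Sum>\<^sub>\<infinity>n. of_int n * theta_term (L / 2) (- L / 2) n) / qprod 1 1 ?q"
    using assms by (intro qbinom_weighted_LIMSEQ q theta_abs_summable) simp
  hence "(\<lambda>N. ?s (Suc N)) \<longlonglongrightarrow> (\<Sum>\<^sub>\<infinity>n. of_int n * theta_term (L / 2) (- L / 2) n) / qprod 1 1 ?q"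
    by (rule LIMSEQ_Suc)
  moreover have "?s (Suc N) = - qfac ?q N * qfac ?q (Suc N)" for N
    using qfac_jacobi_cube[OF q, of N] theta_term_powi[of L 0] by simp
  moreover have "(\<lambda>N. - qfac ?q N * qfac ?q (Suc N)) \<longlonglongrightarrow> - qprod 1 1 ?q * qprod 1 1 ?q"
    by (intro tendsto_mult tendsto_minus LIMSEQ_Suc qfac_LIMSEQ q)
  ultimately have "(\<Sum>\<^sub>\<infinity>n. of_int n * theta_term (L / 2) (- L / 2) n) / qprod 1 1 ?q = - qprod 1 1 ?q * qprod 1 1 ?q"
    by (simp only: LIMSEQ_unique)
  thus ?thesis using nz by (simp add: divide_eq_eq power3_eq_cube)
qed

section \<open>The quintuple product\<close>

lemma sign_mult: "(-1 :: complex) powi m * (-1) powi n = (if even (m + n) then 1 else -1)"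
  by (cases "even m"; cases "even n") auto

text \<open>
  The product on the left has exponent \<open>L (a\<^sup>2 + 3 b\<^sup>2) / 24 + l (a + b) / 2\<close> up to constants, with
  \<open>a\<close> and \<open>b\<close> odd. The reflection of the hexagonal lattice that fixes \<open>a + b\<close> either cancels terms
  in pairs or moves them to the right-hand side.
\<close>
lemma quintuple_product:
  assumes "Re L < 0"
  shows "(theta (3 * L / 2) (L / 2 - 3 * l) + exp l * theta (3 * L / 2) (L / 2 + 3 * l)) * theta (L / 2) (l - L / 2)
           = theta (3 * L / 2) (L / 2) * theta (L / 2) (2 * l - L / 2)"
proof -
  define T1 where "T1 = (\<lambda>(n, m). theta_term (3 * L / 2) (L / 2 - 3 * l) n * theta_term (L / 2) (l - L / 2) m)"
  define T2 where "T2 = (\<lambda>(n, m). exp l * theta_term (3 * L / 2) (L / 2 + 3 * l) n * theta_term (L / 2) (l - L / 2) m)"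
  define R where "R = (\<lambda>(n, m). theta_term (3 * L / 2) (L / 2) n * theta_term (L / 2) (2 * l - L / 2) m)"
  define Ev where "Ev = {(n, m :: int). even (n + m)}"
  define Od where "Od = {(n, m :: int). odd (n + m)}"
  have UN: "Ev \<union> Od = UNIV" "Ev \<inter> Od = {}" by (auto simp: Ev_def Od_def)
  have summ: "(\<lambda>n. norm (theta_term (3 * L / 2) B n)) summable_on UNIV"
             "(\<lambda>n. norm (theta_term (L / 2) B n)) summable_on UNIV" for B
    using assms by (auto intro!: theta_abs_summable)
  have hT1: "(T1 has_sum theta (3 * L / 2) (L / 2 - 3 * l) * theta (L / 2) (l - L / 2)) UNIV"
    unfolding T1_def theta_def by (rule has_sum_Times_mult[OF summ])
  have hT2: "(T2 has_sum exp l * (theta (3 * L / 2) (L / 2 + 3 * l) * theta (L / 2) (l - L / 2))) UNIV"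
    using has_sum_cmult_right[OF has_sum_Times_mult[OF summ(1)[of "L / 2 + 3 * l"] summ(2)[of "l - L / 2"]], of "exp l"]
    unfolding T2_def theta_def by (simp add: case_prod_unfold mult.assoc)
  have hR: "(R has_sum theta (3 * L / 2) (L / 2) * theta (L / 2) (2 * l - L / 2)) UNIV"
    unfolding R_def theta_def by (rule has_sum_Times_mult[OF summ])
  have split: "infsum f UNIV = infsum f Ev + infsum f Od" if "(f has_sum s) UNIV" for f :: "int \<times> int \<Rightarrow> complex" and s
  proof -
    have "f summable_on UNIV" using that by (rule has_sum_imp_summable)
    hence "f summable_on Ev" "f summable_on Od"
      using summable_on_subset_banach by blast+
    from infsum_Un_disjoint[OF this UN(2)] show ?thesis by (simp add: UN)
  qed
  \<comment> \<open>\<open>T1\<close> on \<open>Ev\<close> becomes \<open>R\<close> on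
    \<open>Ev\<close>, \<open>T2\<close> on \<open>Od\<close> becomes \<open>R\<close> on
    \<open>Od\<close>, and \<open>T1\<close> on \<open>Od\<close> cancels \<open>T2\<close> on
    \<open>Ev\<close>. The parameters n, k, c are chosen so that no halves occur in the
    reflections.\<close>
  have T1_even: "T1 (n, 2 * k + 3 * n) = R (- 2 * n - k, k)" for n k
  proof -
    have "T1 (n, 2 * k + 3 * n) = ((-1) powi n * (-1) powi (2 * k + 3 * n)) *
       exp (3 * L / 2 * of_int n ^ 2 + (L / 2 - 3 * l) * of_int n +
         (L / 2 * of_int (2 * k + 3 * n) ^ 2 + (l - L / 2) * of_int (2 * k + 3 * n)))"
      by (simp add: T1_def theta_term_def exp_add)
    also have "(-1 :: complex) powi n * (-1) powi (2 * k + 3 * n) = (-1) powi (- 2 * n - k) * (-1) powi k"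
      unfolding sign_mult by simp
    also have "3 * L / 2 * of_int n ^ 2 + (L / 2 - 3 * l) * of_int n +
         (L / 2 * of_int (2 * k + 3 * n) ^ 2 + (l - L / 2) * of_int (2 * k + 3 * n))
       = 3 * L / 2 * of_int (- 2 * n - k) ^ 2 + L / 2 * of_int (- 2 * n - k) +
         (L / 2 * of_int k ^ 2 + (2 * l - L / 2) * of_int k)"
      by (simp add: field_simps power2_eq_square)
    finally show ?thesis by (simp add: R_def theta_term_def exp_add)
  qed
  have T2_odd: "T2 (n, 2 * k - 1 - 3 * n) = R (k - 1 - 2 * n, k)" for n k
  proof -
    have "T2 (n, 2 * k - 1 - 3 * n) = ((-1) powi n * (-1) powi (2 * k - 1 - 3 * n)) *
       exp (l + (3 * L / 2 * of_int n ^ 2 + (L / 2 + 3 * l) * of_int n +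
         (L / 2 * of_int (2 * k - 1 - 3 * n) ^ 2 + (l - L / 2) * of_int (2 * k - 1 - 3 * n))))"
      by (simp add: T2_def theta_term_def exp_add)
    also have "(-1 :: complex) powi n * (-1) powi (2 * k - 1 - 3 * n) = (-1) powi (k - 1 - 2 * n) * (-1) powi k"
      unfolding sign_mult by simp
    also have "l + (3 * L / 2 * of_int n ^ 2 + (L / 2 + 3 * l) * of_int n +
         (L / 2 * of_int (2 * k - 1 - 3 * n) ^ 2 + (l - L / 2) * of_int (2 * k - 1 - 3 * n)))
       = 3 * L / 2 * of_int (k - 1 - 2 * n) ^ 2 + L / 2 * of_int (k - 1 - 2 * n) +
         (L / 2 * of_int k ^ 2 + (2 * l - L / 2) * of_int k)"
      by (simp add: field_simps power2_eq_square)
    finally show ?thesis by (simp add: R_def theta_term_def exp_add)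
  qed
  have T1_odd: "T1 (n, n + 1 + 2 * c) = - T2 (c, - 2 * n - c)" for n c
  proof -
    have "T1 (n, n + 1 + 2 * c) = ((-1) powi n * (-1) powi (n + 1 + 2 * c)) *
       exp (3 * L / 2 * of_int n ^ 2 + (L / 2 - 3 * l) * of_int n +
         (L / 2 * of_int (n + 1 + 2 * c) ^ 2 + (l - L / 2) * of_int (n + 1 + 2 * c)))"
      by (simp add: T1_def theta_term_def exp_add)
    also have "(-1 :: complex) powi n * (-1) powi (n + 1 + 2 * c) = - ((-1) powi c * (-1) powi (- 2 * n - c))"
      unfolding sign_mult by simp
    also have "3 * L / 2 * of_int n ^ 2 + (L / 2 - 3 * l) * of_int n +
         (L / 2 * of_int (n + 1 + 2 * c) ^ 2 + (l - L / 2) * of_int (n + 1 + 2 * c))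
       = l + (3 * L / 2 * of_int c ^ 2 + (L / 2 + 3 * l) * of_int c +
         (L / 2 * of_int (- 2 * n - c) ^ 2 + (l - L / 2) * of_int (- 2 * n - c)))"
      by (simp add: field_simps power2_eq_square)
    finally show ?thesis by (simp add: T2_def theta_term_def exp_add)
  qed
  \<comment> \<open>The witnesses here and in the next two reindexings solve these parametrisations
    for n and k or c; the parity conditions make the divisions by 2 exact.\<close>
  have "infsum T1 Ev = infsum R Ev"
  proof (rule infsum_reindex_bij_witness[of _ "\<lambda>(N, k). (- ((N + k) div 2), 2 * k + 3 * (- ((N + k) div 2)))"
        "\<lambda>(n, m). (- 2 * n - (m - 3 * n) div 2, (m - 3 * n) div 2)"])
    fix a assume "a \<in> Ev"
    then obtain n k where a: "a = (n, 2 * k + 3 * n)"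
    proof -
      obtain n m where nm: "a = (n, m)" "even (m + n)" using \<open>a \<in> Ev\<close> by (auto simp: Ev_def add.commute)
      hence "even (m - 3 * n)" by simp
      then obtain k where "m - 3 * n = 2 * k" by (elim evenE)
      hence "m = 2 * k + 3 * n" by simp
      with nm that show thesis by blast
    qed
    show "(case case a of (n, m) \<Rightarrow> (- 2 * n - (m - 3 * n) div 2, (m - 3 * n) div 2) of
            (N, k) \<Rightarrow> (- ((N + k) div 2), 2 * k + 3 * (- ((N + k) div 2)))) = a"
      by (simp add: a)
    show "(case a of (n, m) \<Rightarrow> (- 2 * n - (m - 3 * n) div 2, (m - 3 * n) div 2)) \<in> Ev"
      by (simp add: a Ev_def)
    show "R (case a of (n, m) \<Rightarrow> (- 2 * n - (m - 3 * n) div 2, (m - 3 * n) div 2)) = T1 a"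
      using T1_even[of n k] by (simp add: a)
  next
    fix b assume "b \<in> Ev"
    then obtain n k where b: "b = (- 2 * n - k, k)"
    proof -
      obtain N k where nm: "b = (N, k)" "even (N + k)" using \<open>b \<in> Ev\<close> by (auto simp: Ev_def)
      then obtain n where "N + k = 2 * n" by (elim evenE)
      hence "b = (- 2 * (- n) - k, k)" using nm by simp
      with that show thesis by blast
    qed
    show "(case case b of (N, k) \<Rightarrow> (- ((N + k) div 2), 2 * k + 3 * (- ((N + k) div 2))) of
          (n, m) \<Rightarrow> (- 2 * n - (m - 3 * n) div 2, (m - 3 * n) div 2)) = b"
      by (simp add: b)
    show "(case b of (N, k) \<Rightarrow> (- ((N + k) div 2), 2 * k + 3 * (- ((N + k) div 2)))) \<in> Ev"
      by (simp add: b Ev_def)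
  qed
  moreover have "infsum T2 Od = infsum R Od"
  proof (rule infsum_reindex_bij_witness[of _ "\<lambda>(N, k). ((k - 1 - N) div 2, 2 * k - 1 - 3 * ((k - 1 - N) div 2))"
        "\<lambda>(n, m). ((m + 1 + 3 * n) div 2 - 1 - 2 * n, (m + 1 + 3 * n) div 2)"])
    fix a assume "a \<in> Od"
    then obtain n k where a: "a = (n, 2 * k - 1 - 3 * n)"
    proof -
      obtain n m where nm: "a = (n, m)" "odd (n + m)" using \<open>a \<in> Od\<close> by (auto simp: Od_def)
      hence "even (m + 1 + 3 * n)" by simp
      then obtain k where "m + 1 + 3 * n = 2 * k" by (elim evenE)
      hence "m = 2 * k - 1 - 3 * n" by simp
      with nm that show thesis by blast
    qed
    show "(case case a of (n, m) \<Rightarrow> ((m + 1 + 3 * n) div 2 - 1 - 2 * n, (m + 1 + 3 * n) div 2) of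
          (N, k) \<Rightarrow> ((k - 1 - N) div 2, 2 * k - 1 - 3 * ((k - 1 - N) div 2))) = a"
      by (simp add: a)
    show "(case a of (n, m) \<Rightarrow> ((m + 1 + 3 * n) div 2 - 1 - 2 * n, (m + 1 + 3 * n) div 2)) \<in> Od"
      by (simp add: a Od_def)
    show "R (case a of (n, m) \<Rightarrow> ((m + 1 + 3 * n) div 2 - 1 - 2 * n, (m + 1 + 3 * n) div 2)) = T2 a"
      using T2_odd[of n k] by (simp add: a)
  next
    fix b assume "b \<in> Od"
    then obtain n k where b: "b = (k - 1 - 2 * n, k)"
    proof -
      obtain N k where nm: "b = (N, k)" "odd (N + k)" using \<open>b \<in> Od\<close> by (auto simp: Od_def)
      hence "even (k - 1 - N)" by simp
      then obtain n where "k - 1 - N = 2 * n" by (elim evenE)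
      hence "b = (k - 1 - 2 * n, k)" using nm by simp
      with that show thesis by blast
    qed
    show "(case case b of (N, k) \<Rightarrow> ((k - 1 - N) div 2, 2 * k - 1 - 3 * ((k - 1 - N) div 2)) of
          (n, m) \<Rightarrow> ((m + 1 + 3 * n) div 2 - 1 - 2 * n, (m + 1 + 3 * n) div 2)) = b"
      by (simp add: b)
    show "(case b of (N, k) \<Rightarrow> ((k - 1 - N) div 2, 2 * k - 1 - 3 * ((k - 1 - N) div 2))) \<in> Od"
      by (simp add: b Od_def)
  qed
  moreover have "infsum T1 Od = infsum (\<lambda>x. - T2 x) Ev"
  proof (rule infsum_reindex_bij_witness[of _ "\<lambda>(c, m). (- ((m + c) div 2), - ((m + c) div 2) + 1 + 2 * c)"
        "\<lambda>(n, m). ((m - n - 1) div 2, - 2 * n - (m - n - 1) div 2)"])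
    fix a assume "a \<in> Od"
    then obtain n c where a: "a = (n, n + 1 + 2 * c)"
    proof -
      obtain n m where nm: "a = (n, m)" "odd (n + m)" using \<open>a \<in> Od\<close> by (auto simp: Od_def)
      hence "even (m - n - 1)" by simp
      then obtain c where "m - n - 1 = 2 * c" by (elim evenE)
      hence "m = n + 1 + 2 * c" by simp
      with nm that show thesis by blast
    qed
    show "(case case a of (n, m) \<Rightarrow> ((m - n - 1) div 2, - 2 * n - (m - n - 1) div 2) of
          (c, m) \<Rightarrow> (- ((m + c) div 2), - ((m + c) div 2) + 1 + 2 * c)) = a"
      by (simp add: a)
    show "(case a of (n, m) \<Rightarrow> ((m - n - 1) div 2, - 2 * n - (m - n - 1) div 2)) \<in> Ev"
      by (simp add: a Ev_def)
    show "- T2 (case a of (n, m) \<Rightarrow> ((m - n - 1) div 2, - 2 * n - (m - n - 1) div 2)) = T1 a"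
      using T1_odd[of n c] by (simp add: a)
  next
    fix b assume "b \<in> Ev"
    then obtain n c where b: "b = (c, - 2 * n - c)"
    proof -
      obtain c m where nm: "b = (c, m)" "even (m + c)" using \<open>b \<in> Ev\<close> by (auto simp: Ev_def add.commute)
      then obtain n where "m + c = 2 * n" by (elim evenE)
      hence "b = (c, - 2 * (- n) - c)" using nm by simp
      with that show thesis by blast
    qed
    show "(case case b of (c, m) \<Rightarrow> (- ((m + c) div 2), - ((m + c) div 2) + 1 + 2 * c) of
          (n, m) \<Rightarrow> ((m - n - 1) div 2, - 2 * n - (m - n - 1) div 2)) = b"
      by (simp add: b)
    show "(case b of (c, m) \<Rightarrow> (- ((m + c) div 2), - ((m + c) div 2) + 1 + 2 * c)) \<in> Od"
      by (simp add: b Od_def)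
  qed
  moreover have "infsum (\<lambda>x. - T2 x) Ev = - infsum T2 Ev"
    by (rule infsum_uminus)
  ultimately have "infsum T1 UNIV + infsum T2 UNIV = infsum R UNIV"
    unfolding split[OF hT1] split[OF hT2] split[OF hR] by simp
  thus ?thesis
    using infsumI[OF hT1] infsumI[OF hT2] infsumI[OF hR] by (simp add: algebra_simps)
qed

section \<open>The 7-dissection of the Euler product\<close>

text \<open>The products without their fractional powers of q; unlike u, v, w they make sense on the
  whole disc, including 0.\<close>

definition klein_u :: "complex \<Rightarrow> complex"
  where "klein_u q = qprod 7 3 q * qprod 7 4 q * qprod 7 7 q"

definition klein_v :: "complex \<Rightarrow> complex"
  where "klein_v q = qprod 7 2 q * qprod 7 5 q * qprod 7 7 q"

definition klein_w :: "complex \<Rightarrow> complex"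
  where "klein_w q = qprod 7 1 q * qprod 7 6 q * qprod 7 7 q"

lemma klein_nonzero:
  assumes "norm q < 1"
  shows "klein_u q \<noteq> 0" "klein_v q \<noteq> 0" "klein_w q \<noteq> 0"
  using qprod_nonzero[OF assms, of 7] by (simp_all add: klein_u_def klein_v_def klein_w_def)

text \<open>With nome \<open>exp (7 * M)\<close> the quintuple product reads S(a) T(a) = e T(2a).
  Since T(a) = T(7 - a), doubling permutes the three products cyclically: 1 to 2, 2 to 4
  (equivalently 3), 3 to 6 (equivalently 1).\<close>

lemma quintuple_klein:
  assumes "Re M < 0"
  defines "S \<equiv> \<lambda>a. theta (21 * M / 2) (7 * M / 2 - 3 * a * M) + exp (a * M) * theta (21 * M / 2) (7 * M / 2 + 3 * a * M)"
  defines "e \<equiv> qprod 1 1 (exp (7 * M))"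
  shows "S 1 = e * (klein_v (exp M) / klein_w (exp M))"
    and "S 2 = e * (klein_u (exp M) / klein_v (exp M))"
    and "S 3 = e * (klein_w (exp M) / klein_u (exp M))"
proof -
  define T where "T a = theta (7 * M / 2) (a * M - 7 * M / 2)" for a
  have quint: "S a * T a = e * T (2 * a)" for a
    using quintuple_product[of "7 * M" "a * M"] euler_pentagonal[of "7 * M"] assms(1)
    by (simp add: S_def T_def e_def algebra_simps)
  have T: "T 1 = klein_w (exp M)" "T 2 = klein_v (exp M)" "T 3 = klein_u (exp M)"
       "T 4 = klein_u (exp M)" "T 6 = klein_w (exp M)"
    using theta_product[OF assms(1), of 1 7] theta_product[OF assms(1), of 2 7] theta_product[OF assms(1), of 3 7]
      theta_product[OF assms(1), of 4 7] theta_product[OF assms(1), of 6 7]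
    by (simp_all add: T_def klein_u_def klein_v_def klein_w_def mult_ac)
  have nz: "klein_u (exp M) \<noteq> 0" "klein_v (exp M) \<noteq> 0" "klein_w (exp M) \<noteq> 0"
    using klein_nonzero[of "exp M"] assms(1) by simp_all
  show "S 1 = e * (klein_v (exp M) / klein_w (exp M))"
    using quint[of 1] nz by (simp add: T divide_simps)
  show "S 2 = e * (klein_u (exp M) / klein_v (exp M))"
    using quint[of 2] nz by (simp add: T divide_simps)
  show "S 3 = e * (klein_w (exp M) / klein_u (exp M))"
    using quint[of 3] nz by (simp add: T divide_simps)
qed

lemma infsum_int_residues_7:
  fixes f :: "int \<Rightarrow> complex"
  assumes "f summable_on UNIV"
  shows "(\<Sum>\<^sub>\<infinity>n. f n) = (\<Sum>s\<in>{-3..3}. \<Sum>\<^sub>\<infinity>k. f (7 * k + s))"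
proof -
  have "(\<Sum>s\<in>{-3..3::int}. infsum f (range (\<lambda>k. 7 * k + s))) = infsum f (\<Union>s\<in>{-3..3::int}. range (\<lambda>k. 7 * k + s))"
  proof (rule sum_infsum)
    fix s s' :: int assume "s \<in> {-3..3}" "s' \<in> {-3..3}" "s \<noteq> s'"
    thus "range (\<lambda>k. 7 * k + s) \<inter> range (\<lambda>k. 7 * k + s') = {}"
      by auto presburger
  qed (use assms summable_on_subset_banach in auto)
  also have "(\<Union>s\<in>{-3..3::int}. range (\<lambda>k. 7 * k + s)) = UNIV"
  proof -
    have "n \<in> (\<Union>s\<in>{-3..3::int}. range (\<lambda>k. 7 * k + s))" for n
    proof (rule UN_I)
      show "(n + 3) mod 7 - 3 \<in> {-3..3}" by auto
      show "n \<in> range (\<lambda>k. 7 * k + ((n + 3) mod 7 - 3))"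
        by (rule range_eqI[of _ _ "(n + 3) div 7"]) presburger
    qed
    thus ?thesis by blast
  qed
  finally show ?thesis
    by (simp add: infsum_reindex inj_def o_def)
qed

lemma euler_dissection_7:
  assumes "norm q < 1" "q \<noteq> 0"
  defines "p \<equiv> q ^ 7"
  shows "qprod 1 1 q = qprod 1 1 (p ^ 7) *
    (klein_v p / klein_w p - q * (klein_u p / klein_v p) - q\<^sup>2 + q ^ 5 * (klein_w p / klein_u p))"
proof -
  define L where "L = Ln q"
  define M where "M = 7 * L"
  have q: "q = exp L" using assms by (simp add: L_def)
  have L: "Re L < 0" using assms(1) by (simp add: q)
  hence M: "Re M < 0" by (simp add: M_def)
  have p: "p = exp M" "p ^ 7 = exp (7 * M)"
    by (simp_all add: p_def q M_def flip: exp_of_nat_mult)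
  define c where "c s = (\<Sum>\<^sub>\<infinity>k. theta_term (3 * L / 2) (L / 2) (7 * k + s))" for s
  have c: "c s = (-1) powi s * exp (of_int s * (3 * of_int s + 1) / 2 * L) * theta (21 * M / 2) ((6 * of_int s + 1) * M / 2)" for s
  proof -
    have "theta_term (3 * L / 2) (L / 2) (7 * k + s)
       = (-1) powi s * exp (of_int s * (3 * of_int s + 1) / 2 * L) * theta_term (21 * M / 2) ((6 * of_int s + 1) * M / 2) k" for k
    proof -
      have "(-1 :: complex) powi (7 * k + s) = (-1) powi s * (-1) powi k"
        unfolding sign_mult by (auto simp: power_int_minus_left)
      moreover have "3 * L / 2 * of_int (7 * k + s) ^ 2 + L / 2 * of_int (7 * k + s)
          = of_int s * (3 * of_int s + 1) / 2 * L + (21 * M / 2 * of_int k ^ 2 + (6 * of_int s + 1) * M / 2 * of_int k)"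
        by (simp add: M_def field_simps power2_eq_square)
      ultimately show ?thesis
        unfolding theta_term_def by (simp add: exp_add)
    qed
    thus ?thesis unfolding c_def theta_def by (simp add: infsum_cmult_right')
  qed
  define S where "S = (\<lambda>a. theta (21 * M / 2) (7 * M / 2 - 3 * a * M) + exp (a * M) * theta (21 * M / 2) (7 * M / 2 + 3 * a * M))"
  have S: "S 1 = qprod 1 1 (p ^ 7) * (klein_v p / klein_w p)" "S 2 = qprod 1 1 (p ^ 7) * (klein_u p / klein_v p)"
    "S 3 = qprod 1 1 (p ^ 7) * (klein_w p / klein_u p)"
    unfolding S_def p(2) unfolding p(1) by (rule quintuple_klein[OF M])+
  have "qprod 1 1 q = (\<Sum>s\<in>{-3..3}. c s)"
    unfolding c_def q euler_pentagonal[OF L, symmetric] theta_def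
    by (rule infsum_int_residues_7) (use L in \<open>auto intro!: abs_summable_summable theta_abs_summable\<close>)
  also have "{-3..3::int} = {-3, -2, -1, 0, 1, 2, 3}" by auto
  \<comment> \<open>For s = -3, ..., 3 the exponents s(3s+1)/2 are 12, 5, 1, 0, 2, 7, 15. Modulo 7
    they pair s = 0 with 2, -1 with 3 and -2 with -3; s = 1 stays alone and is again a pentagonal
    series.\<close>
  also have "(\<Sum>s\<in>\<dots>. c s) = (c 0 + c 2) + (c (-1) + c 3) + c 1 + (c (-2) + c (-3))" by simp
  also have "c 0 + c 2 = S 1"
    by (simp add: c S_def M_def algebra_simps)
  also have "c (-1) + c 3 = - q * S 2"
    by (simp add: c S_def M_def q algebra_simps flip: exp_add)
  also have "c 1 = - q\<^sup>2 * qprod 1 1 (p ^ 7)"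
    using euler_pentagonal[of "7 * M"] M
    by (simp add: c q p(2) power2_eq_square flip: exp_add)
  also have "c (-2) + c (-3) = q ^ 5 * S 3"
  proof -
    \<comment> \<open>Only this pair needs a shift of the summation index to take the shape of
      \<open>S 3\<close>.\<close>
    have "theta (21 * M / 2) (7 * M / 2 + 3 * 3 * M) = - exp (- 2 * M) * theta (21 * M / 2) (- 17 * M / 2)"
      using theta_shift[of "21 * M / 2" "- 17 * M / 2"] by (simp add: field_simps)
    thus ?thesis
      by (simp add: c S_def M_def q field_simps exp_pow flip: exp_add)
  qed
  finally show ?thesis
    unfolding S by (simp add: algebra_simps)
qed

section \<open>Filtering by seventh roots of unity and the Klein quartic\<close>

definition zeta7 :: complex
  where "zeta7 = exp (2 * of_real pi * \<i> / 7)"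

lemma zeta7_power_eq_1_iff: "zeta7 ^ n = 1 \<longleftrightarrow> 7 dvd n"
  using complex_root_unity_eq_1[of 7 n] by (simp add: zeta7_def mult_ac flip: exp_of_nat_mult)

lemma zeta7_power_7 [simp]: "zeta7 ^ 7 = 1"
  by (simp add: zeta7_power_eq_1_iff)

lemma norm_zeta7 [simp]: "norm zeta7 = 1"
  by (simp add: zeta7_def norm_exp_eq_Re)

lemma sum_root_unity_7:
  fixes z :: complex
  assumes "z ^ 7 = 1" "z \<noteq> 1"
  shows "(\<Sum>j<7. z ^ j) = 0"
  using power_diff_1_eq[of z 7] assms by simp

lemma has_sum_sum:
  fixes f :: "'i \<Rightarrow> 'a \<Rightarrow> complex"
  assumes "finite I" "\<And>i. i \<in> I \<Longrightarrow> (f i has_sum s i) A"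
  shows "((\<lambda>x. \<Sum>i\<in>I. f i x) has_sum (\<Sum>i\<in>I. s i)) A"
  using assms by (induction I rule: finite_induct) (auto intro!: has_sum_add)

text \<open>Jacobi's exponents \<open>n (n - 1) / 2\<close> are never congruent to \<open>2\<close> modulo \<open>7\<close>.\<close>
lemma euler_cube_residue_2:
  assumes "norm q < 1" "q \<noteq> 0"
  shows "(\<Sum>j<7. zeta7 ^ (5 * j) * qprod 1 1 (zeta7 ^ j * q) ^ 3) = 0"
proof -
  define t where "t n = nat (n * (n - 1) div 2)" for n :: int
  define a where "a n = of_int n * (-1 :: complex) powi n" for n :: int
  have tri: "n * (n - 1) div 2 \<ge> 0" for n :: int
    by (cases "n > 0") (auto intro!: mult_nonneg_nonneg mult_nonpos_nonpos simp: pos_imp_zdiv_nonneg_iff)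
  have cube: "((\<lambda>n. a n * x ^ t n) has_sum (- (qprod 1 1 x ^ 3))) UNIV" if x: "norm x < 1" "x \<noteq> 0" for x
  proof -
    have L: "x = exp (Ln x)" "Re (Ln x) < 0"
      using x by auto
    have "of_int n * theta_term (Ln x / 2) (- Ln x / 2) n = a n * x ^ t n" for n
      using theta_term_powi[of "Ln x" 0 n] x tri[of n] by (simp add: a_def t_def power_int_nonneg_exp)
    moreover have "((\<lambda>n. of_int n * theta_term (Ln x / 2) (- Ln x / 2) n) has_sum
        (\<Sum>\<^sub>\<infinity>n. of_int n * theta_term (Ln x / 2) (- Ln x / 2) n)) UNIV"
      using L by (intro has_sum_infsum, intro abs_summable_summable[OF theta_abs_summable(2)]) simp
    ultimately show ?thesis
      using jacobi_cube[OF L(2)] L(1) by simp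
  qed
  have "((\<lambda>n. \<Sum>j<7. zeta7 ^ (5 * j) * (a n * (zeta7 ^ j * q) ^ t n)) has_sum
      (\<Sum>j<7. zeta7 ^ (5 * j) * (- (qprod 1 1 (zeta7 ^ j * q) ^ 3)))) UNIV"
    using assms by (intro has_sum_sum has_sum_cmult_right cube) (auto simp: norm_mult norm_power zeta7_def)
  moreover have "(\<Sum>j<7. zeta7 ^ (5 * j) * (a n * (zeta7 ^ j * q) ^ t n)) = 0" for n
  proof -
    \<comment> \<open>The weight \<open>zeta7 ^ (5 * j)\<close> isolates the exponents congruent to
      2 modulo 7, as 5 + 2 = 7.\<close>
    have "(\<Sum>j<7. zeta7 ^ (5 * j) * (a n * (zeta7 ^ j * q) ^ t n))
        = a n * q ^ t n * (\<Sum>j<7. (zeta7 ^ (5 + t n)) ^ j)"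
      by (simp add: sum_distrib_left power_add power_mult_distrib mult_ac flip: power_mult)
    moreover have "(\<Sum>j<7. (zeta7 ^ (5 + t n)) ^ j) = 0"
    proof (rule sum_root_unity_7)
      show "(zeta7 ^ (5 + t n)) ^ 7 = 1"
        by (simp add: zeta7_power_eq_1_iff flip: power_mult)
      \<comment> \<open>The congruence n(n-1)/2 = 2 would make 3 = (2n-1)^2 a square modulo 7. The
        check runs over the residues of n, with everything doubled to avoid the division.\<close>
      have "\<not> 7 dvd (5 + t n)"
      proof
        assume "7 dvd (5 + t n)"
        hence "7 dvd int (5 + t n)" by presburger
        moreover have "2 * int (5 + t n) = 10 + n * (n - 1)"
          using tri[of n] by (simp add: t_def)
        ultimately have dvd: "7 dvd 10 + n * (n - 1)"
          by (metis dvd_mult)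
        define r where "r = n mod 7"
        define k where "k = n div 7"
        have n: "n = 7 * k + r" by (simp add: k_def r_def)
        have "10 + n * (n - 1) = 7 * (7 * k * k + 2 * k * r - k) + (10 + r * (r - 1))"
          unfolding n by (simp add: algebra_simps)
        with dvd have "7 dvd 10 + r * (r - 1)" by (simp add: dvd_add_right_iff)
        moreover have "r \<in> {0, 1, 2, 3, 4, 5, 6}" unfolding r_def by auto
        ultimately show False by auto
      qed
      thus "zeta7 ^ (5 + t n) \<noteq> 1" by (simp add: zeta7_power_eq_1_iff)
    qed
    ultimately show ?thesis by simp
  qed
  ultimately have "(\<Sum>j<7. zeta7 ^ (5 * j) * (- (qprod 1 1 (zeta7 ^ j * q) ^ 3))) = 0"
    using has_sum_unique[OF _ has_sum_0] by fastforce
  thus ?thesis by (simp add: sum_negf)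
qed

text \<open>The same filter applied to the cube of a four-term dissection: only the monomials of
  W-degree 2 modulo 7 survive, each multiplied by 7.\<close>

lemma cube_residue_component:
  fixes x y z t :: complex
  shows "(\<Sum>j<7. zeta7 ^ (5 * j) * (x + zeta7 ^ j * y + (zeta7 ^ j)\<^sup>2 * z + (zeta7 ^ j) ^ 5 * t) ^ 3)
           = 21 * (x\<^sup>2 * z + x * y\<^sup>2 + z\<^sup>2 * t)"
proof -
  have expand: "W ^ 5 * (x + W * y + W\<^sup>2 * z + W ^ 5 * t) ^ 3 =
      (3*x^2*z + 3*x*y^2 + 3*z^2*t) + (6*x*y*z + 3*x*t^2 + y^3) * W + (3*x*z^2 + 3*y^2*z + 3*y*t^2) * W ^ 2
      + (3*x^2*t + 3*y*z^2 + 3*z*t^2) * W ^ 3 + (6*x*y*t + z^3) * W ^ 4 + (x^3 + 6*x*z*t + 3*y^2*t) * W ^ 5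
      + (3*x^2*y + 6*y*z*t + t^3) * W ^ 6"
    if "W ^ 7 = 1" for W
  proof -
    \<comment> \<open>The last factor is the quotient in the division by
      \<open>W ^ 7 - 1\<close>.\<close>
    have "W ^ 5 * (x + W * y + W\<^sup>2 * z + W ^ 5 * t) ^ 3 =
      (3*x^2*z + 3*x*y^2 + 3*z^2*t) + (6*x*y*z + 3*x*t^2 + y^3) * W + (3*x*z^2 + 3*y^2*z + 3*y*t^2) * W ^ 2
      + (3*x^2*t + 3*y*z^2 + 3*z*t^2) * W ^ 3 + (6*x*y*t + z^3) * W ^ 4 + (x^3 + 6*x*z*t + 3*y^2*t) * W ^ 5
      + (3*x^2*y + 6*y*z*t + t^3) * W ^ 6 + (W ^ 7 - 1) *
      (W^13*t^3 +3*W^10*z*t^2 +3*W^9*y*t^2 +3*W^8*x*t^2 +3*W^7*z^2*t +6*W^6*y*z*t +W^6*t^3 +6*W^5*x*z*t +3*W^5*y^2*t +6*W^4*x*y*t +W^4*z^3 +3*W^3*x^2*t +3*W^3*y*z^2 +3*W^3*z*t^2 +3*W^2*x*z^2 +3*W^2*y^2*z +3*W^2*y*t^2 +6*W*x*y*z +3*W*x*t^2 +W*y^3 +3*x^2*z +3*x*y^2 +3*z^2*t)"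
      by algebra
    thus ?thesis using that by simp
  qed
  have sums: "(\<Sum>j<7. (zeta7 ^ j) ^ i) = 0" if "\<not> 7 dvd i" for i
  proof -
    have "(\<Sum>j<7. (zeta7 ^ i) ^ j) = 0"
      using that by (intro sum_root_unity_7) (simp_all add: zeta7_power_eq_1_iff flip: power_mult)
    thus ?thesis by (simp add: mult.commute flip: power_mult)
  qed
  have "(\<Sum>j<7. zeta7 ^ (5 * j) * (x + zeta7 ^ j * y + (zeta7 ^ j)\<^sup>2 * z + (zeta7 ^ j) ^ 5 * t) ^ 3)
     = (\<Sum>j<7. (zeta7 ^ j) ^ 5 * (x + zeta7 ^ j * y + (zeta7 ^ j)\<^sup>2 * z + (zeta7 ^ j) ^ 5 * t) ^ 3)"
    by (simp add: mult.commute[of 5] power_mult)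
  also have "\<dots> = (\<Sum>j<7. (3*x^2*z + 3*x*y^2 + 3*z^2*t) + (6*x*y*z + 3*x*t^2 + y^3) * (zeta7 ^ j) ^ 1 + (3*x*z^2 + 3*y^2*z + 3*y*t^2) * (zeta7 ^ j) ^ 2
      + (3*x^2*t + 3*y*z^2 + 3*z*t^2) * (zeta7 ^ j) ^ 3 + (6*x*y*t + z^3) * (zeta7 ^ j) ^ 4 + (x^3 + 6*x*z*t + 3*y^2*t) * (zeta7 ^ j) ^ 5
      + (3*x^2*y + 6*y*z*t + t^3) * (zeta7 ^ j) ^ 6)"
    by (intro sum.cong refl, subst expand) (simp_all add: zeta7_power_eq_1_iff flip: power_mult)
  also have "\<dots> = 7 * (3*x^2*z + 3*x*y^2 + 3*z^2*t)"
    unfolding sum.distrib sum_distrib_left[symmetric] by (subst sums, simp)+ simp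
  finally show ?thesis by (simp add: algebra_simps)
qed

text \<open>Twisting q by a seventh root of unity leaves p unchanged, so only the explicit powers of
  q change.\<close>

lemma euler_dissection_7_twisted:
  assumes "norm q < 1" "q \<noteq> 0"
  defines "p \<equiv> q ^ 7"
  defines "E \<equiv> qprod 1 1 (p ^ 7)"
  shows "qprod 1 1 (zeta7 ^ j * q) = E * (klein_v p / klein_w p) + zeta7 ^ j * (- q * E * (klein_u p / klein_v p))
           + (zeta7 ^ j)\<^sup>2 * (- q\<^sup>2 * E) + (zeta7 ^ j) ^ 5 * (q ^ 5 * E * (klein_w p / klein_u p))"
proof -
  have "norm (zeta7 ^ j * q) < 1" "zeta7 ^ j * q \<noteq> 0"
    using assms by (simp_all add: norm_mult norm_power zeta7_def)
  moreover have "(zeta7 ^ j * q) ^ 7 = p"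
    by (simp add: p_def power_mult_distrib zeta7_power_eq_1_iff flip: power_mult)
  ultimately show ?thesis
    using euler_dissection_7[of "zeta7 ^ j * q"] by (simp add: E_def algebra_simps power_mult_distrib)
qed

lemma exists_seventh_root:
  fixes p :: complex
  assumes "norm p < 1" "p \<noteq> 0"
  obtains q where "norm q < 1" "q \<noteq> 0" "q ^ 7 = p"
proof (rule that[of "exp (Ln p / 7)"])
  show "norm (exp (Ln p / 7)) < 1" using assms by simp
  show "exp (Ln p / 7) ^ 7 = p" using assms by (simp flip: exp_of_nat_mult)
qed simp

text \<open>The missing residue 2 in \<open>E(q)^3\<close>, read off from the dissection, gives the
  relation after division by \<open>21 * q\<^sup>2 * E ^ 3\<close>. In u, v, w it says u v^3 = u^3 w
  + v w^3, which is Klein's quartic up to signs.\<close>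

lemma klein_quartic:
  assumes p: "norm p < 1"
  defines "A \<equiv> klein_v p / klein_w p" and "B \<equiv> klein_u p / klein_v p" and "D \<equiv> klein_w p / klein_u p"
  shows "p * D = A\<^sup>2 - A * B\<^sup>2"
proof (cases "p = 0")
  case True
  thus ?thesis by (simp add: A_def B_def klein_u_def klein_v_def klein_w_def)
next
  case False
  then obtain q where q: "norm q < 1" "q \<noteq> 0" "q ^ 7 = p"
    using exists_seventh_root[OF p] by blast
  define E where "E = qprod 1 1 (p ^ 7)"
  have E: "E \<noteq> 0" unfolding E_def using norm_power_lt_1[OF p] by (intro qprod_nonzero) auto
  have "21 * ((E * A)\<^sup>2 * (- q\<^sup>2 * E) + (E * A) * (- q * E * B)\<^sup>2 + (- q\<^sup>2 * E)\<^sup>2 * (q ^ 5 * E * D)) = 0"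
    using euler_cube_residue_2[OF q(1,2)]
    unfolding euler_dissection_7_twisted[OF q(1,2)] cube_residue_component q(3)
    by (simp only: E_def A_def B_def D_def)
  moreover have "21 * ((E * A)\<^sup>2 * (- q\<^sup>2 * E) + (E * A) * (- q * E * B)\<^sup>2 + (- q\<^sup>2 * E)\<^sup>2 * (q ^ 5 * E * D))
      = (21 * q\<^sup>2 * E ^ 3) * (- (A\<^sup>2) + A * B\<^sup>2 + p * D)"
    unfolding q(3)[symmetric] by algebra
  ultimately have "- (A\<^sup>2) + A * B\<^sup>2 + p * D = 0"
    using E q(2) by simp
  thus ?thesis by algebra
qed

section \<open>The norm form of the dissection\<close>

text \<open>As \<open>W ^ 6\<close> is the inverse of W, the product is symmetric under inversion
  and involves only the sums W^k + W^(-k).\<close>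

lemma norm_conjugate_pair:
  fixes W x y z t :: complex
  assumes "W ^ 7 = 1"
  shows "(x + y * W + z * W ^ 2 + t * W ^ 5) * (x + y * W ^ 6 + z * W ^ 5 + t * W ^ 2)
     = (x^2 + y^2 + z^2 + t^2) + (x*y + y*z) * (W + W ^ 6) + (x*z + t*x) * (W ^ 2 + W ^ 5)
       + (z*t + y*t) * (W ^ 3 + W ^ 4)"
  using assms by algebra

text \<open>
  With \<open>c = 2 cos (2 \<pi> / 7)\<close>, the numbers \<open>d\<close> and \<open>e\<close> are its conjugates. The last factor in the proof is
  the quotient by the minimal polynomial of \<open>c\<close>.
\<close>
lemma cubic_norm_7:
  fixes c g0 g1 g2 g3 :: complex
  assumes "c ^ 3 + c ^ 2 - 2 * c - 1 = 0" and d: "d = c ^ 2 - 2" and e: "e = 1 - c - c ^ 2"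
  shows "(g0 + g1*c + g2*d + g3*e) * (g0 + g1*d + g2*e + g3*c) * (g0 + g1*e + g2*c + g3*d) =
      g0^3 - g0^2*g1 - g0^2*g2 - g0^2*g3 - 2*g0*g1^2 + 3*g0*g1*g2 + 3*g0*g1*g3 - 2*g0*g2^2
      + 3*g0*g2*g3 - 2*g0*g3^2 + g1^3 + 3*g1^2*g2 - 4*g1^2*g3 - 4*g1*g2^2 - g1*g2*g3 + 3*g1*g3^2
      + g2^3 + 3*g2^2*g3 - 4*g2*g3^2 + g3^3"
proof -
  have "(g0 + g1*c + g2*d + g3*e) * (g0 + g1*d + g2*e + g3*c) * (g0 + g1*e + g2*c + g3*d) =
      g0^3 - g0^2*g1 - g0^2*g2 - g0^2*g3 - 2*g0*g1^2 + 3*g0*g1*g2 + 3*g0*g1*g3 - 2*g0*g2^2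
      + 3*g0*g2*g3 - 2*g0*g3^2 + g1^3 + 3*g1^2*g2 - 4*g1^2*g3 - 4*g1*g2^2 - g1*g2*g3 + 3*g1*g3^2
      + g2^3 + 3*g2^2*g3 - 4*g2*g3^2 + g3^3
      + (c ^ 3 + c ^ 2 - 2 * c - 1) * (c^3*g1^2*g3 - c^3*g1^2*g2 + c^3*g1*g2^2 - c^3*g1*g3^2 - c^3*g2^2*g3 + c^3*g2*g3^2
      - c^2*g1^3 + c^2*g1^2*g2 + 2*c^2*g1^2*g3 + 2*c^2*g1*g2^2 - 6*c^2*g1*g2*g3 + c^2*g1*g3^2
      - c^2*g2^3 + c^2*g2^2*g3 + 2*c^2*g2*g3^2 - c^2*g3^3 - c*g0*g1^2 + c*g0*g1*g2 + c*g0*g1*g3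
      - c*g0*g2^2 + c*g0*g2*g3 - c*g0*g3^2 + 5*c*g1^2*g2 - 4*c*g1^2*g3 - 4*c*g1*g2^2
      - 3*c*g1*g2*g3 + 5*c*g1*g3^2 + 5*c*g2^2*g3 - 4*c*g2*g3^2 + g1^3 - g1^2*g2 - 2*g1^2*g3
      - 2*g1*g2^2 + 6*g1*g2*g3 - g1*g3^2 + g2^3 - g2^2*g3 - 2*g2*g3^2 + g3^3)"
    unfolding d e by algebra
  with assms(1) show ?thesis by simp
qed

text \<open>Apart from j = 0 the factors form three inverse pairs, each linear in the cubic periods
  c, d, e. The pairs differ by a cyclic permutation of c, d, e, so their product is the norm from
  \<open>cubic_norm_7\<close>.\<close>

lemma norm_form_7:
  fixes w x y z t :: complex
  assumes w: "w ^ 7 = 1" "w \<noteq> 1"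
  shows "(\<Prod>j<7. x + w ^ j * y + (w ^ j)\<^sup>2 * z + (w ^ j) ^ 5 * t) =
      x^7 - 7*x^5*z*t + 7*x^4*y^2*t - 7*x^3*y*z^3 + 14*x^3*z^2*t^2 + 14*x^2*y^3*z^2
      - 7*x^2*y^2*z*t^2 + 7*x^2*y*t^4 - 7*x*y^5*z + 7*x*y^4*t^2 + 14*x*y*z^4*t - 7*x*z^3*t^3
      + y^7 - 7*y^3*z^3*t + 14*y^2*z^2*t^3 - 7*y*z*t^5 + z^7 + t^7"
proof -
  have sum: "1 + w + w ^ 2 + w ^ 3 + w ^ 4 + w ^ 5 + w ^ 6 = 0"
    using sum_root_unity_7[OF w] by (simp add: eval_nat_numeral algebra_simps)
  define c where "c = w + w ^ 6"
  define d where "d = w ^ 2 + w ^ 5"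
  define e where "e = w ^ 3 + w ^ 4"
  define g0 where "g0 = x^2 + y^2 + z^2 + t^2"
  define g1 where "g1 = x*y + y*z"
  define g2 where "g2 = x*z + t*x"
  define g3 where "g3 = z*t + y*t"
  define F where "F W = x + y * W + z * W ^ 2 + t * W ^ 5" for W
  have red: "w ^ (7 + n) = w ^ n" for n by (simp add: power_add w)
  have reds: "w ^ 8 = w" "w ^ 9 = w ^ 2" "w ^ 10 = w ^ 3" "w ^ 12 = w ^ 5" "w ^ 15 = w" "w ^ 18 = w ^ 4"
      "w ^ 14 = 1" "w ^ 21 = 1" "w ^ 20 = w ^ 6" "w ^ 25 = w ^ 4" "w ^ 30 = w ^ 2"
    using red[of 1] red[of 2] red[of 3] red[of 5] red[of 8] red[of 11] red[of 4] red[of 13] red[of 6]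
      red[of 18] red[of 23] red[of 16] red[of 9] red[of 7] red[of 14] w(1) by simp_all
  have p1: "F w * F (w ^ 6) = g0 + g1 * c + g2 * d + g3 * e"
    using norm_conjugate_pair[OF w(1), of x y z t]
    by (simp add: F_def g0_def g1_def g2_def g3_def c_def d_def e_def reds flip: power_mult)
  have p2: "F (w ^ 2) * F (w ^ 5) = g0 + g1 * d + g2 * e + g3 * c"
    using norm_conjugate_pair[of "w ^ 2" x y z t] w(1)
    by (simp add: F_def g0_def g1_def g2_def g3_def c_def d_def e_def reds power_mult[symmetric] add.commute)
  have p3: "F (w ^ 3) * F (w ^ 4) = g0 + g1 * e + g2 * c + g3 * d"
    using norm_conjugate_pair[of "w ^ 3" x y z t] w(1)
    by (simp add: F_def g0_def g1_def g2_def g3_def c_def d_def e_def reds power_mult[symmetric] add.commute)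
  have d: "d = c ^ 2 - 2" and cd: "c * d = c + e"
    using w(1) unfolding c_def d_def e_def by algebra+
  have e: "e = 1 - c - c ^ 2"
    using sum unfolding d[unfolded diff_eq_eq, symmetric] c_def d_def e_def by algebra
  have c: "c ^ 3 + c ^ 2 - 2 * c - 1 = 0"
    using cd unfolding d e by algebra
  have "(\<Prod>j<7. x + w ^ j * y + (w ^ j)\<^sup>2 * z + (w ^ j) ^ 5 * t) = (\<Prod>j<7. F (w ^ j))"
    by (simp add: F_def mult.commute)
  also have "\<dots> = F 1 * ((F w * F (w ^ 6)) * (F (w ^ 2) * F (w ^ 5)) * (F (w ^ 3) * F (w ^ 4)))"
    by (simp add: lessThan_nat_numeral lessThan_Suc mult_ac)
  also have "\<dots> = (x + y + z + t) * (
      g0^3 - g0^2*g1 - g0^2*g2 - g0^2*g3 - 2*g0*g1^2 + 3*g0*g1*g2 + 3*g0*g1*g3 - 2*g0*g2^2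
      + 3*g0*g2*g3 - 2*g0*g3^2 + g1^3 + 3*g1^2*g2 - 4*g1^2*g3 - 4*g1*g2^2 - g1*g2*g3 + 3*g1*g3^2
      + g2^3 + 3*g2^2*g3 - 4*g2*g3^2 + g3^3)"
    unfolding p1 p2 p3 cubic_norm_7[OF c d e] by (simp add: F_def)
  also have "\<dots> =
      x^7 - 7*x^5*z*t + 7*x^4*y^2*t - 7*x^3*y*z^3 + 14*x^3*z^2*t^2 + 14*x^2*y^3*z^2
      - 7*x^2*y^2*z*t^2 + 7*x^2*y*t^4 - 7*x*y^5*z + 7*x*y^4*t^2 + 14*x*y*z^4*t - 7*x*z^3*t^3
      + y^7 - 7*y^3*z^3*t + 14*y^2*z^2*t^3 - 7*y*z*t^5 + z^7 + t^7"
    unfolding g0_def g1_def g2_def g3_def by algebra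
  finally show ?thesis .
qed

text \<open>
  The left-hand side is the norm form at \<open>x = A, y = - q B, z = - q\<^sup>2, t = q\<^sup>5 D\<close> with \<open>p = q\<^sup>7\<close>.
\<close>
lemma norm_form_on_klein_quartic:
  fixes A B D p :: complex
  assumes ABD: "A * B * D = 1" and p: "p = A^3 * B - A^2 * B^3"
  shows "A^7 + 7*p*A^5*D + 7*p*A^4*B^2*D - 7*p*A^3*B + 14*p^2*A^3*D^2 - 14*p*A^2*B^3
      + 7*p^2*A^2*B^2*D^2 - 7*p^3*A^2*B*D^4 - 7*p*A*B^5 + 7*p^2*A*B^4*D^2 - 14*p^2*A*B*D
      + 7*p^3*A*D^3 - p*B^7 - 7*p^2*B^3*D + 14*p^3*B^2*D^3 - 7*p^4*B*D^5 - p^2 + p^5*D^7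
      = (A^3 * B + p * B^3 * D - p^2 * D^3 * A - 8 * p)\<^sup>2"
proof -
  \<comment> \<open>Once p is eliminated, the two sides differ by a multiple of
    \<open>A * B * D - 1\<close>; the long factor is the quotient.\<close>
  have "A^7 + 7*p*A^5*D + 7*p*A^4*B^2*D - 7*p*A^3*B + 14*p^2*A^3*D^2 - 14*p*A^2*B^3
      + 7*p^2*A^2*B^2*D^2 - 7*p^3*A^2*B*D^4 - 7*p*A*B^5 + 7*p^2*A*B^4*D^2 - 14*p^2*A*B*D
      + 7*p^3*A*D^3 - p*B^7 - 7*p^2*B^3*D + 14*p^3*B^2*D^3 - 7*p^4*B*D^5 - p^2 + p^5*D^7
      = (A^3 * B + p * B^3 * D - p^2 * D^3 * A - 8 * p)\<^sup>2
      + (A * B * D - 1) * (A^14*B^4*D^6 - 5*A^13*B^6*D^6 + 10*A^12*B^8*D^6 - A^12*B^5*D^5 - 10*A^11*B^10*D^6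
      + 4*A^11*B^7*D^5 - 8*A^11*B^4*D^4 + 5*A^10*B^12*D^6 - 6*A^10*B^9*D^5 + 32*A^10*B^6*D^4
      - 15*A^10*B^3*D^3 - A^9*B^14*D^6 + 4*A^9*B^11*D^5 - 48*A^9*B^8*D^4 + 55*A^9*B^5*D^3
      - 22*A^9*B^2*D^2 - A^8*B^13*D^5 + 32*A^8*B^10*D^4 - 75*A^8*B^7*D^3 + 92*A^8*B^4*D^2
      - 8*A^8*B*D - 8*A^7*B^12*D^4 + 45*A^7*B^9*D^3 - 142*A^7*B^6*D^2 + 71*A^7*B^3*D - A^7
      - 10*A^6*B^11*D^3 + 96*A^6*B^8*D^2 - 135*A^6*B^5*D + 57*A^6*B^2 - 24*A^5*B^10*D^2
      + 88*A^5*B^7*D - 107*A^5*B^4 - 15*A^4*B^9*D + 58*A^4*B^6 - A^3*B^11*D - 6*A^3*B^8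
      - A^2*B^10)"
    unfolding p by algebra
  with ABD show ?thesis by simp
qed

section \<open>The identity on the unit disc\<close>

lemma prod_one_minus_root_unity_7:
  fixes w X :: complex
  assumes "w ^ 7 = 1" "w \<noteq> 1"
  shows "(\<Prod>j<7. 1 - w ^ j * X) = 1 - X ^ 7"
  using norm_form_7[OF assms, of 1 "- X" 0 0] by simp

lemma prod_lessThan_add:
  fixes g :: "nat \<Rightarrow> complex"
  shows "(\<Prod>k<m + n. g k) = (\<Prod>k<m. g k) * (\<Prod>i<n. g (m + i))"
  by (induction n) (simp_all add: mult_ac)

text \<open>The product of 1 - (zeta^j q)^n over j is 1 - p^n if 7 does not divide n, and (1 -
  p^(n/7))^7 if it does. Multiplying by the product at p^7 restores the factors 1 - p^n with 7
  dividing n.\<close>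

lemma euler_norm_7:
  assumes q: "norm q < 1"
  defines "p \<equiv> q ^ 7"
  shows "(\<Prod>j<7. qprod 1 1 (zeta7 ^ j * q)) * qprod 1 1 (p ^ 7) = qprod 1 1 p ^ 8"
proof -
  have p: "norm p < 1" "norm (p ^ 7) < 1"
    using norm_power_lt_1[OF q, of 7] norm_power_lt_1[of p 7] by (simp_all add: p_def)
  define f where "f k = (\<Prod>j<7. 1 - (zeta7 ^ j * q) ^ (1 * k + 1))" for k
  have f_not_dvd: "f k = 1 - p ^ (1 * k + 1)" if "\<not> 7 dvd (k + 1)" for k
  proof -
    have "f k = (\<Prod>j<7. 1 - (zeta7 ^ (k + 1)) ^ j * q ^ (k + 1))"
      unfolding f_def power_mult_distrib by (simp only: power_mult[symmetric] mult_1 mult.commute)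
    also have "\<dots> = 1 - (q ^ (k + 1)) ^ 7"
      using that by (intro prod_one_minus_root_unity_7) (simp_all add: zeta7_power_eq_1_iff flip: power_mult del: power_Suc)
    finally show ?thesis by (simp only: p_def power_mult[symmetric] mult.commute mult_1)
  qed
  \<comment> \<open>The factor with index k has exponent k + 1, so the multiples of 7 sit at k = 7m
    + 6.\<close>
  have f_dvd: "f (7 * m + 6) = (1 - p ^ (1 * m + 1)) ^ 7" for m
  proof -
    have "(zeta7 ^ j * q) ^ (1 * (7 * m + 6) + 1) = p ^ (1 * m + 1)" for j
    proof -
      have "1 * (7 * m + 6) + 1 = 7 * (m + 1)" by simp
      moreover have "(zeta7 ^ j) ^ (7 * (m + 1)) = 1"
        by (simp add: zeta7_power_eq_1_iff flip: power_mult)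
      ultimately show ?thesis
        by (simp only: power_mult_distrib p_def power_mult[of q] mult_1)
    qed
    thus ?thesis by (simp only: f_def prod_constant card_lessThan)
  qed
  have block: "(\<Prod>i<7. f (7 * m + i)) * (1 - (p ^ 7) ^ (1 * m + 1))
      = (\<Prod>i<7. 1 - p ^ (1 * (7 * m + i) + 1)) * (1 - p ^ (1 * m + 1)) ^ 7" for m
  proof -
    have "(\<Prod>i<7. f (7 * m + i)) = (\<Prod>i<6. f (7 * m + i)) * f (7 * m + 6)"
      using prod.lessThan_Suc[of "\<lambda>i. f (7 * m + i)" 6] by simp
    moreover have "(\<Prod>i<6. f (7 * m + i)) = (\<Prod>i<6. 1 - p ^ (1 * (7 * m + i) + 1))"
    proof (intro prod.cong refl f_not_dvd)
      fix i :: nat assume "i \<in> {..<6}"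
      thus "\<not> 7 dvd (7 * m + i + 1)" by auto presburger
    qed
    moreover have "(\<Prod>i<7. 1 - p ^ (1 * (7 * m + i) + 1))
        = (\<Prod>i<6. 1 - p ^ (1 * (7 * m + i) + 1)) * (1 - p ^ (1 * (7 * m + 6) + 1))"
      using prod.lessThan_Suc[of "\<lambda>i. 1 - p ^ (1 * (7 * m + i) + 1)" 6] by simp
    moreover have "(p ^ 7) ^ (1 * m + 1) = p ^ (1 * (7 * m + 6) + 1)"
      unfolding power_mult[symmetric] by (rule arg_cong[of _ _ "\<lambda>n. p ^ n"]) simp
    ultimately show ?thesis unfolding f_dvd by (simp only: mult_ac)
  qed
  have group: "(\<Prod>k<7 * N. g k) = (\<Prod>m<N. \<Prod>i<7. g (7 * m + i))" for g :: "nat \<Rightarrow> complex" and N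
  proof (induction N)
    case (Suc N)
    have "(\<Prod>k<7 * N + 7. g k) = (\<Prod>k<7 * N. g k) * (\<Prod>i<7. g (7 * N + i))"
      by (rule prod_lessThan_add)
    thus ?case using Suc by (simp add: add.commute)
  qed simp
  have "(\<Prod>k<7 * N. f k) * (\<Prod>m<N. 1 - (p ^ 7) ^ (1 * m + 1))
      = (\<Prod>k<7 * N. 1 - p ^ (1 * k + 1)) * (\<Prod>m<N. 1 - p ^ (1 * m + 1)) ^ 7" for N
    unfolding group prod_power_distrib prod.distrib[symmetric] block ..
  moreover have "(\<lambda>N. (\<Prod>k<7 * N. f k) * (\<Prod>m<N. 1 - (p ^ 7) ^ (1 * m + 1)))
      \<longlonglongrightarrow> (\<Prod>j<7. qprod 1 1 (zeta7 ^ j * q)) * qprod 1 1 (p ^ 7)"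
  proof (intro tendsto_mult qprod_LIMSEQ p)
    have "(\<Prod>k<7 * N. f k) = (\<Prod>j<7. \<Prod>k<7 * N. 1 - (zeta7 ^ j * q) ^ (1 * k + 1))" for N
      unfolding f_def by (rule prod.swap)
    moreover have "(\<lambda>N. \<Prod>j<7. \<Prod>k<7 * N. 1 - (zeta7 ^ j * q) ^ (1 * k + 1))
        \<longlonglongrightarrow> (\<Prod>j<7. qprod 1 1 (zeta7 ^ j * q))"
      using q by (intro tendsto_prod tendsto_prod_merge qprod_LIMSEQ) (simp_all add: norm_mult norm_power)
    ultimately show "(\<lambda>N. \<Prod>k<7 * N. f k) \<longlonglongrightarrow> (\<Prod>j<7. qprod 1 1 (zeta7 ^ j * q))" by simp
  qed simp
  moreover have "(\<lambda>N. (\<Prod>k<7 * N. 1 - p ^ (1 * k + 1)) * (\<Prod>m<N. 1 - p ^ (1 * m + 1)) ^ 7)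
      \<longlonglongrightarrow> qprod 1 1 p * qprod 1 1 p ^ 7"
    by (intro tendsto_mult tendsto_power tendsto_prod_merge qprod_LIMSEQ p) simp_all
  ultimately have "(\<Prod>j<7. qprod 1 1 (zeta7 ^ j * q)) * qprod 1 1 (p ^ 7) = qprod 1 1 p * qprod 1 1 p ^ 7"
    by (simp only: LIMSEQ_unique)
  thus ?thesis by (simp add: eval_nat_numeral)
qed

text \<open>This is q (eta(\<tau>) / eta(7\<tau>))^4 at p = q; the extra q removes the pole at 0.
  \<open>klein_sum\<close> is likewise q times the first left-hand side minus 8.\<close>

definition eta_quot :: "complex \<Rightarrow> complex"
  where "eta_quot p = (qprod 1 1 p / qprod 1 1 (p ^ 7)) ^ 4"

definition klein_sum :: "complex \<Rightarrow> complex"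
  where "klein_sum p = klein_v p ^ 2 * klein_u p / klein_w p ^ 3 + p * (klein_u p ^ 2 * klein_w p / klein_v p ^ 3)
           - p ^ 2 * (klein_w p ^ 2 * klein_v p / klein_u p ^ 3) - 8 * p"

lemma klein_sum_sq_eq:
  assumes p: "norm p < 1"
  shows "klein_sum p ^ 2 = eta_quot p ^ 2"
proof (cases "p = 0")
  case True
  thus ?thesis by (simp add: klein_sum_def eta_quot_def klein_u_def klein_v_def klein_w_def)
next
  case False
  then obtain q where q: "norm q < 1" "q \<noteq> 0" "q ^ 7 = p"
    using exists_seventh_root[OF p] by blast
  define E where "E = qprod 1 1 (p ^ 7)"
  define A where "A = klein_v p / klein_w p"
  define B where "B = klein_u p / klein_v p"
  define D where "D = klein_w p / klein_u p"
  have E: "E \<noteq> 0" unfolding E_def using norm_power_lt_1[OF p] by (intro qprod_nonzero) auto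
  note nz = klein_nonzero[OF p]
  have ABD: "A * B * D = 1" using nz by (simp add: A_def B_def D_def)
  have "p * D = A\<^sup>2 - A * B\<^sup>2" using klein_quartic[OF p] by (simp add: A_def B_def D_def)
  \<comment> \<open>Multiplying the quartic by \<open>A * B\<close> eliminates D from the left-hand
    side.\<close>
  with ABD have p_eq: "p = A^3 * B - A^2 * B^3" by algebra
  have zeta7: "zeta7 \<noteq> 1" using zeta7_power_eq_1_iff[of 1] by simp
  have "(\<Prod>j<7. qprod 1 1 (zeta7 ^ j * q)) =
      (\<Prod>j<7. E * A + zeta7 ^ j * (- q * E * B) + (zeta7 ^ j)\<^sup>2 * (- q\<^sup>2 * E) + (zeta7 ^ j) ^ 5 * (q ^ 5 * E * D))"
    unfolding euler_dissection_7_twisted[OF q(1,2)] q(3) by (simp only: E_def A_def B_def D_def)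
  also have "\<dots> = E ^ 7 * (A^7 + 7*p*A^5*D + 7*p*A^4*B^2*D - 7*p*A^3*B + 14*p^2*A^3*D^2 - 14*p*A^2*B^3
      + 7*p^2*A^2*B^2*D^2 - 7*p^3*A^2*B*D^4 - 7*p*A*B^5 + 7*p^2*A*B^4*D^2 - 14*p^2*A*B*D
      + 7*p^3*A*D^3 - p*B^7 - 7*p^2*B^3*D + 14*p^3*B^2*D^3 - 7*p^4*B*D^5 - p^2 + p^5*D^7)"
    unfolding norm_form_7[OF zeta7_power_7 zeta7] q(3)[symmetric] by algebra
  also have "\<dots> = E ^ 7 * (A^3 * B + p * B^3 * D - p^2 * D^3 * A - 8 * p)\<^sup>2"
    by (simp only: norm_form_on_klein_quartic[OF ABD p_eq])
  also have "A^3 * B + p * B^3 * D - p^2 * D^3 * A - 8 * p = klein_sum p"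
    \<comment> \<open>The three monomials are \<open>A^3 * B\<close>, \<open>B^3 * D\<close> and
      \<open>D^3 * A\<close> written back in the Klein products.\<close>
    using nz by (simp add: klein_sum_def A_def B_def D_def field_simps eval_nat_numeral)
  finally have "E ^ 7 * klein_sum p ^ 2 * E = qprod 1 1 p ^ 8"
    using euler_norm_7[OF q(1)] by (simp add: q(3) E_def)
  hence "klein_sum p ^ 2 * E ^ 8 = qprod 1 1 p ^ 8"
    by (simp add: eval_nat_numeral mult_ac)
  thus ?thesis using E unfolding E_def
    by (simp add: eta_quot_def power_divide field_simps flip: power_mult)
qed

lemma klein_sum_eq_eta_quot:
  assumes p: "norm p < 1"
  shows "klein_sum p = eta_quot p"
proof -
  define f where "f p = klein_sum p / eta_quot p" for p
  have nz: "eta_quot p \<noteq> 0" if "norm p < 1" for p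
    using that norm_power_lt_1[OF that, of 7] qprod_nonzero[of _ 1 1] by (simp add: eta_quot_def)
  have "continuous_on (ball 0 1) (\<lambda>p. qprod 1 1 (p ^ 7))"
    by (rule continuous_on_compose2[OF qprod_continuous[of 1 1]])
       (auto intro!: continuous_intros simp: norm_power power_less_one_iff)
  moreover have "qprod 1 1 (p ^ 7) \<noteq> 0" if "norm p < 1" for p
    using norm_power_lt_1[OF that, of 7] by (intro qprod_nonzero) auto
  ultimately have "continuous_on (ball 0 1) eta_quot"
    unfolding eta_quot_def by (intro continuous_intros qprod_continuous) auto
  moreover have "continuous_on (ball 0 1) klein_u" "continuous_on (ball 0 1) klein_v" "continuous_on (ball 0 1) klein_w"
    unfolding klein_u_def klein_v_def klein_w_def by (auto intro!: continuous_intros qprod_continuous)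
  hence "continuous_on (ball 0 1) klein_sum"
    unfolding klein_sum_def by (intro continuous_intros) (auto simp: klein_nonzero)
  ultimately have "continuous_on (ball 0 1) f"
    unfolding f_def by (intro continuous_intros) (auto simp: nz)
  moreover have "f x \<in> {1, -1}" if "x \<in> ball 0 1" for x
    using klein_sum_sq_eq[of x] nz[of x] that by (auto simp: f_def power2_eq_iff)
  hence "finite (f ` ball 0 1)"
    by (meson finite.emptyI finite.insertI finite_subset image_subsetI)
  \<comment> \<open>A continuous function with finitely many values on a connected set is constant,
    so its value at 0 decides the sign.\<close>
  ultimately have "f constant_on ball 0 1"
    by (intro continuous_finite_range_constant) simp_all
  hence "f p = f 0" using p by (auto simp: constant_on_def)
  also have "f 0 = 1"
    by (simp add: f_def klein_sum_def eta_quot_def klein_u_def klein_v_def klein_w_def)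
  finally show ?thesis using nz[OF p] by (simp add: f_def)
qed

section \<open>Return to the functions of \<tau>\<close>

lemma prodinf_qprod_triple:
  assumes "norm q < 1"
  shows "(\<Prod>k. (1 - q ^ (7 * k + a)) * (1 - q ^ (7 * k + b)) * (1 - q ^ (7 * k + c))) = qprod 7 a q * qprod 7 b q * qprod 7 c q"
  using qprod_convergent[OF assms, of 7]
  by (simp add: qprod_def prodinf_mult convergent_prod_mult)

theorem theorem6:
  fixes \<tau> :: complex
  assumes "Im \<tau> > 0"
  shows "(v_fun \<tau> ^ 2 * u_fun \<tau> / w_fun \<tau> ^ 3 + u_fun \<tau> ^ 2 * w_fun \<tau> / v_fun \<tau> ^ 3
           - w_fun \<tau> ^ 2 * v_fun \<tau> / u_fun \<tau> ^ 3 = (eta \<tau> / eta (7 * \<tau>)) ^ 4 + 8)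
    \<and> (w_fun \<tau> ^ 3 / (v_fun \<tau> ^ 2 * u_fun \<tau>) + v_fun \<tau> ^ 3 / (u_fun \<tau> ^ 2 * w_fun \<tau>)
           - u_fun \<tau> ^ 3 / (w_fun \<tau> ^ 2 * v_fun \<tau>) = - ((eta \<tau> / eta (7 * \<tau>)) ^ 4) - 5)"
proof -
  define q where "q = qq \<tau>"
  have q: "norm q < 1" "q \<noteq> 0"
    using assms by (simp_all add: q_def qq_def)
  note nz = klein_nonzero[OF q(1)]
  \<comment> \<open>A single 56th root of q turns all fractional powers into integral ones. The
    three quotients then carry s^(-56), s^0 and s^56, that is 1/q, 1 and q.\<close>
  define s where "s = qpow (1 / 56) \<tau>"
  have s: "s \<noteq> 0" "qpow (9 / 56) \<tau> = s ^ 9" "qpow (25 / 56) \<tau> = s ^ 25" "q = s ^ 56"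
    by (simp_all add: s_def qpow_def q_def qq_def mult_ac flip: exp_of_nat_mult)
  have uvw: "u_fun \<tau> = s * klein_u q" "v_fun \<tau> = s ^ 9 * klein_v q" "w_fun \<tau> = s ^ 25 * klein_w q"
    unfolding u_fun_def v_fun_def w_fun_def klein_u_def klein_v_def klein_w_def
      q_def[symmetric] s_def[symmetric] s(2,3) prodinf_qprod_triple[OF q(1)] by (rule refl)+
  define a where "a = klein_v q ^ 2 * klein_u q / klein_w q ^ 3 / q"
  define b where "b = klein_u q ^ 2 * klein_w q / klein_v q ^ 3"
  define c where "c = - q * (klein_w q ^ 2 * klein_v q / klein_u q ^ 3)"
  have a: "v_fun \<tau> ^ 2 * u_fun \<tau> / w_fun \<tau> ^ 3 = a"
    using s(1) nz by (simp add: uvw a_def s(4) power_mult_distrib divide_simps flip: power_mult power_add power_Suc power_Suc2)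
  have b: "u_fun \<tau> ^ 2 * w_fun \<tau> / v_fun \<tau> ^ 3 = b"
    using s(1) nz by (simp add: uvw b_def power_mult_distrib divide_simps flip: power_mult power_add)
  have c: "w_fun \<tau> ^ 2 * v_fun \<tau> / u_fun \<tau> ^ 3 = - c"
    using s(1) nz by (simp add: uvw c_def s(4) power_mult_distrib divide_simps flip: power_mult power_add)
  have eta: "(eta \<tau> / eta (7 * \<tau>)) ^ 4 = eta_quot q / q"
  proof -
    define e where "e = qpow (1 / 24) \<tau>"
    have e: "e \<noteq> 0" "qpow (1 / 24) (7 * \<tau>) = e ^ 7" "q = e ^ 24" "qq (7 * \<tau>) = q ^ 7"
      by (simp_all add: e_def qpow_def q_def qq_def mult_ac flip: exp_of_nat_mult)
    have "eta \<tau> = e * qprod 1 1 q" "eta (7 * \<tau>) = e ^ 7 * qprod 1 1 (q ^ 7)"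
      by (simp_all add: eta_def e e_def qprod_def flip: q_def)
    hence "(eta \<tau> / eta (7 * \<tau>)) ^ 4 = (1 / e ^ 6 * (qprod 1 1 q / qprod 1 1 (q ^ 7))) ^ 4"
      using e(1) by (simp add: eval_nat_numeral)
    thus ?thesis
      by (simp add: eta_quot_def power_mult_distrib e(3) power_divide flip: power_mult)
  qed
  have "a + b + c = eta_quot q / q + 8"
    using klein_sum_eq_eta_quot[OF q(1)] q(2)
    by (simp add: klein_sum_def a_def b_def c_def field_simps power2_eq_square)
  \<comment> \<open>These relations give 1/a + 1/b + 1/c = 3 - (a + b + c), which turns the first
    claim into the second: 3 - 8 = -5.\<close>
  moreover have "a * (1 - b) = 1" "b * (1 - c) = 1" "c * (1 - a) = 1"
  proof -
    define A where "A = klein_v q / klein_w q"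
    define B where "B = klein_u q / klein_v q"
    define D where "D = klein_w q / klein_u q"
    have ABD: "A * B * D = 1" using nz by (simp add: A_def B_def D_def)
    have qD: "q * D = A\<^sup>2 - A * B\<^sup>2" using klein_quartic[OF q(1)] by (simp add: A_def B_def D_def)
    have abc: "a = A ^ 3 * B / q" "b = B ^ 3 * D" "c = - q * (D ^ 3 * A)"
      using nz by (simp_all add: a_def b_def c_def A_def B_def D_def field_simps eval_nat_numeral)
    have "A ^ 3 * B * (1 - B ^ 3 * D) = q" using ABD qD by algebra
    thus "a * (1 - b) = 1" using q(2) by (simp add: abc)
    show "b * (1 - c) = 1" unfolding abc using ABD qD by algebra
    have "c * (1 - a) = - (D ^ 3 * A) * (q - A ^ 3 * B)" using q(2) by (simp add: abc field_simps)
    also have "\<dots> = 1" using ABD qD by algebra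
    finally show "c * (1 - a) = 1" .
  qed
  moreover have "1 / x = y" if "x * y = 1" for x y :: complex
    using that by (cases "x = 0") (simp_all add: field_simps)
  ultimately have inv: "1 / a = 1 - b" "1 / b = 1 - c" "1 / c = 1 - a" and sum: "a + b + c = eta_quot q / q + 8"
    by blast+
  have r: "w_fun \<tau> ^ 3 / (v_fun \<tau> ^ 2 * u_fun \<tau>) = 1 / a" "v_fun \<tau> ^ 3 / (u_fun \<tau> ^ 2 * w_fun \<tau>) = 1 / b"
    unfolding a[symmetric] b[symmetric] by simp_all
  have r': "u_fun \<tau> ^ 3 / (w_fun \<tau> ^ 2 * v_fun \<tau>) = - (1 / c)"
    using c by (metis divide_divide_eq_right minus_divide_right mult_1 minus_minus)
  have h: "eta_quot q / q = a + b + c - 8" using sum by simp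
  show ?thesis unfolding a b c r r' eta inv h by simp
qed

end
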